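(* For every integer $n\ge 1$, the zeros of the polynomial $\tilde p_n(\zeta;\pi)$ (in the variable $\zeta$) are real and distinct. Furthermore, for every $N\in\mathbb N$ there exists a non-negative real number $r_N$ such that the interval $(-r_N,0]$ contains no zeros of $\tilde p_n(\zeta;\pi)$ for all $1\le n<N$; in particular, $r_N$ decreases as $N$ increases.
   Context: For an integer $m\ge 0$ put $\gamma_m(x):=x^m/m!$ (with $\gamma_0\equiv 1$). For $n\ge 1$, $\theta\in[-\pi,\pi]$ and $\zeta\in\mathbb C$ define $$\tilde p_n(\zeta;\theta):=\sum_{j=0}^{n}\gamma_{n-j}\big((j+1)\zeta\big)-e^{-i\theta}\sum_{j=0}^{n-1}\gamma_{n-1-j}\big((j+1)\zeta\big)-\gamma_n(-\zeta/\alpha),$$ with the parameter $\alpha=1$. In particular $\tilde p_n(\zeta;\pi)=\sum_{j=0}^{n}\gamma_{n-j}((j+1)\zeta)+\sum_{j=0}^{n-1}\gamma_{n-1-j}((j+1)\zeta)-\gamma_n(-\zeta)$. *)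

theory Defs
  imports Complex_Main "HOL-Computational_Algebra.Polynomial"
begin

definition gam :: "nat \<Rightarrow> complex \<Rightarrow> complex" where
  "gam m x = x ^ m / fact m"

definition ptilde :: "real \<Rightarrow> nat \<Rightarrow> real \<Rightarrow> complex \<Rightarrow> complex" where
  "ptilde \<alpha> n \<theta> \<zeta> =
     (\<Sum>j=0..n. gam (n - j) (of_nat (j + 1) * \<zeta>))
     - exp (- \<i> * complex_of_real \<theta>)
         * (\<Sum>j=0..<n. gam (n - 1 - j) (of_nat (j + 1) * \<zeta>))
     - gam n (- \<zeta> / complex_of_real \<alpha>)"

(* The same expression as a formal polynomial in \<zeta>, so that multiplicities of zeros
   can be expressed by the library's order; poly_ptilde_poly below relates the two. *)

definition gam_poly :: "nat \<Rightarrow> complex \<Rightarrow> complex poly" where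
  "gam_poly m c = monom (c ^ m / fact m) m"

definition ptilde_poly :: "real \<Rightarrow> nat \<Rightarrow> real \<Rightarrow> complex poly" where
  "ptilde_poly \<alpha> n \<theta> =
     (\<Sum>j=0..n. gam_poly (n - j) (of_nat (j + 1)))
     - smult (exp (- \<i> * complex_of_real \<theta>))
         (\<Sum>j=0..<n. gam_poly (n - 1 - j) (of_nat (j + 1)))
     - gam_poly n (- 1 / complex_of_real \<alpha>)"

lemma poly_gam_poly: "poly (gam_poly m c) \<zeta> = gam m (c * \<zeta>)"
  by (simp add: gam_poly_def gam_def poly_monom power_mult_distrib)

lemma poly_ptilde_poly: "poly (ptilde_poly \<alpha> n \<theta>) \<zeta> = ptilde \<alpha> n \<theta> \<zeta>"
  by (simp add: ptilde_poly_def ptilde_def poly_sum poly_gam_poly)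

lemma ptilde_pi:
  "ptilde 1 n pi \<zeta> =
     (\<Sum>j=0..n. gam (n - j) (of_nat (j + 1) * \<zeta>))
     + (\<Sum>j=0..<n. gam (n - 1 - j) (of_nat (j + 1) * \<zeta>))
     - gam n (- \<zeta>)"
proof -
  have "exp (- \<i> * complex_of_real pi) = -1"
    by (simp add: exp_minus)
  then show ?thesis
    by (simp add: ptilde_def)
qed

end

theory Submission
  imports Defs "HOL-Analysis.Analysis"
begin

text \<open>
  Put \<open>\<zeta> = - y\<close>. The two sums in \<open>ptilde\<close> are values \<open>K (n + 1)\<close> and \<open>K n\<close> of the solution
  of the delay equation \<open>K' s = - y * K (s - 1)\<close> with \<open>K = 1\<close> on \<open>{0..<1}\<close> and \<open>K = 0\<close> before.
  This solution oscillates slowly: consecutive zeros in \<open>s\<close> are more than 1 apart. Hence the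
  polynomials \<open>K 1, K 2, \<dots>\<close> in \<open>y\<close> form a Sturm chain, and \<open>K n\<close> has \<open>n - 1\<close> simple positive
  roots at which the sign of \<open>K (n + 1)\<close> alternates. At such a root the polynomial in question
  equals \<open>K (n + 1) - y ^ n / fact n\<close>, so it remains to show \<open>K (n + 1) > y ^ n / fact n\<close> where
  \<open>K (n + 1)\<close> is positive. Pairing \<open>K\<close> with an exponential solution \<open>exp (l * s)\<close> of the delay
  equation gives \<open>\<bar>K (n + 1)\<bar> \<ge> exp (n * Re l)\<close> (up to a factor if \<open>Re l < 0\<close>), which suffices
  for all roots except the largest one or two. Those are replaced by an explicit point at which a
  single term of the polynomial dominates. This yields as many sign changes as the degree.
\<close>

section \<open>The delay equation\<close>

text \<open>\<open>F y k a\<close> is \<open>K (k + a)\<close> for \<open>0 \<le> a < 1\<close>, where \<open>K\<close> solves \<open>K' s = - y * K (s - 1)\<close>.\<close>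

definition F :: "real \<Rightarrow> nat \<Rightarrow> real \<Rightarrow> real" where
  "F y k a = (\<Sum>i\<le>k. (- y) ^ i * (real (k - i) + a) ^ i / fact i)"

lemma F_0 [simp]: "F y 0 a = 1"
  by (simp add: F_def)

lemma F_zero [simp]: "F 0 k a = 1"
  by (simp add: F_def power_0_left if_distrib if_distribR sum.If_cases cong: if_cong)

text \<open>Continuity of \<open>K\<close> at integers: the extra summand \<open>i = Suc k\<close>
  on the left is a positive power of 0.\<close>

lemma F_Suc_0: "F y (Suc k) 0 = F y k 1"
proof -
  have "real (Suc k - i) + 0 = real (k - i) + 1" if "i \<le> k" for i
    using that by (simp add: Suc_diff_le)
  then have "(\<Sum>i\<le>k. (- y) ^ i * (real (Suc k - i) + 0) ^ i / fact i) = F y k 1"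
    unfolding F_def by (intro sum.cong refl) (simp only: atMost_iff)
  then show ?thesis by (simp add: F_def)
qed

text \<open>The delay equation. As \<open>F y k\<close> is a polynomial in \<open>a\<close>, it
  holds at every real \<open>a\<close>, so the ends of the unit interval need no one-sided
  derivatives.\<close>

lemma F_has_derivative:
  "((\<lambda>a. F y (Suc k) a) has_real_derivative - y * F y k a) (at a within S)"
proof -
  have "((\<lambda>a. F y (Suc k) a) has_real_derivative
      (\<Sum>i\<le>Suc k. (- y) ^ i * (real i * (real (Suc k - i) + a) ^ (i - 1)) / fact i)) (at a within S)"
    unfolding F_def by (intro DERIV_sum) (auto intro!: derivative_eq_intros)
  also have "(\<Sum>i\<le>Suc k. (- y) ^ i * (real i * (real (Suc k - i) + a) ^ (i - 1)) / fact i)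
      = (\<Sum>i\<le>k. (- y) ^ Suc i * (real (Suc i) * (real (k - i) + a) ^ i) / fact (Suc i))"
    by (subst sum.atMost_Suc_shift) (simp add: lessThan_Suc_atMost)
  also have "\<dots> = - y * F y k a"
    unfolding F_def sum_distrib_left
  proof (rule sum.cong[OF refl])
    fix i
    have f: "fact (Suc i) = real (Suc i) * fact i" by simp
    show "(- y) ^ Suc i * (real (Suc i) * (real (k - i) + a) ^ i) / fact (Suc i) =
         - y * ((- y) ^ i * (real (k - i) + a) ^ i / fact i)"
      unfolding f by (simp del: of_nat_Suc)
  qed
  finally show ?thesis .
qed

lemma F_continuous [continuous_intros]: "continuous_on S (F y k)"
  unfolding F_def by (intro continuous_intros) auto

section \<open>Slow oscillation: at most one sign change per unit interval\<close>

text \<open>The crossing may sit at an end of the interval, where one of the two sign conditions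
  becomes vacuous. Upward crossings are expressed by applying the notion to the negated
  function.\<close>

definition single_crossing :: "(real \<Rightarrow> real) \<Rightarrow> bool" where
  "single_crossing g \<longleftrightarrow> (\<forall>u\<in>{0..1}. g u > 0) \<or>
     (\<exists>z\<in>{0..1}. g z = 0 \<and> (\<forall>u\<in>{0..<z}. g u > 0) \<and> (\<forall>u\<in>{z<..1}. g u < 0))"

lemma strict_decreasing_of_deriv:
  fixes h g :: "real \<Rightarrow> real"
  assumes "\<And>u. (h has_real_derivative - y * g u) (at u)" "y > 0"
    and "a < b" "\<And>u. a < u \<Longrightarrow> u < b \<Longrightarrow> g u > 0"
  shows "h b < h a"
proof (rule DERIV_neg_imp_decreasing_open[OF \<open>a < b\<close>])
  fix x assume "a < x" "x < b"
  then show "\<exists>y. DERIV h x :> y \<and> y < 0"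
    using assms(1)[of x] assms(2) assms(4)[of x] by (intro exI[of _ "- y * g x"]) auto
next
  show "continuous_on {a..b} h"
    using assms(1) by (meson DERIV_continuous continuous_at_imp_continuous_on)
qed

text \<open>While \<open>g\<close> is positive \<open>h\<close> falls, while \<open>g\<close> is
  negative \<open>h\<close> rises, and \<open>h\<close> starts at \<open>g 1\<close>. If
  \<open>g\<close> stays positive, \<open>h\<close> starts positive and falls. If \<open>g\<close>
  crosses at \<open>z\<close>, then \<open>h\<close> starts at or below 0, falls up to
  \<open>z\<close> and rises afterwards. Both shapes cross 0 at most once.\<close>

lemma single_crossing_step:
  fixes h g :: "real \<Rightarrow> real"
  assumes h: "\<And>u. (h has_real_derivative - y * g u) (at u)" and y: "y > 0"
    and h0: "h 0 = g 1" and g: "single_crossing g"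
  shows "single_crossing h \<or> single_crossing (\<lambda>u. - h u)"
proof -
  have cont: "continuous_on S h" for S
    using h by (meson DERIV_continuous continuous_at_imp_continuous_on)
  have dec: "h b < h a" if "a < b" "\<And>u. a < u \<Longrightarrow> u < b \<Longrightarrow> g u > 0" for a b
    by (rule strict_decreasing_of_deriv[OF h y that])
  have inc: "h a < h b" if "a < b" "\<And>u. a < u \<Longrightarrow> u < b \<Longrightarrow> g u < 0" for a b
  proof -
    have "((\<lambda>u. - h u) has_real_derivative - y * (- g u)) (at u)" for u
      by (rule DERIV_cong[OF DERIV_minus[OF h]]) simp
    from strict_decreasing_of_deriv[OF this y \<open>a < b\<close>] that(2) show ?thesis by auto
  qed
  from g consider (pos) "\<forall>u\<in>{0..1}. g u > 0"
    | (cross) z where "0 \<le> z" "z \<le> 1" "g z = 0" "\<forall>u\<in>{0..<z}. g u > 0" "\<forall>u\<in>{z<..1}. g u < 0"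
    unfolding single_crossing_def by auto
  then show ?thesis
  proof cases
    case pos
    then have h0': "h 0 > 0" using h0 by simp
    have d: "h b < h a" if "a < b" "0 \<le> a" "b \<le> 1" for a b
      using dec[OF that(1)] pos that by auto
    show ?thesis
    proof (cases "h 1 > 0")
      case True
      have "h u > 0" if "u \<in> {0..1}" for u
        using d[of u 1] True that by (cases "u = 1") auto
      then show ?thesis by (simp add: single_crossing_def)
    next
      case False
      then obtain z where z: "0 \<le> z" "z \<le> 1" "h z = 0"
        using IVT2'[of h 1 0 0] cont h0' by auto
      have "single_crossing h" unfolding single_crossing_def
        using z d[of _ z] d[of z _] by (intro disjI2 bexI[of _ z]) force+
      then show ?thesis ..
    qed
  next
    case cross
    show ?thesis
    proof (cases "z = 1")
      \<comment> \<open>Here \<open>h 0 = g 1 = 0\<close> and \<open>h\<close> falls at once, so its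
        crossing is the left end.\<close>
      case True
      have "h u < 0" if "u \<in> {0<..1}" for u
        using dec[of 0 u] cross that True h0 by auto
      then have "single_crossing h" unfolding single_crossing_def
        using h0 cross True by (intro disjI2 bexI[of _ 0]) auto
      then show ?thesis ..
    next
      case False
      have h0': "h 0 < 0" using cross False h0 by auto
      have neg: "h u < 0" if "0 \<le> u" "u \<le> z" for u
        using dec[of 0 u] cross(4) that h0' by (cases "u = 0") auto
      have i: "h a < h b" if "a < b" "z \<le> a" "b \<le> 1" for a b
        using inc[OF that(1)] cross(5) that by auto
      show ?thesis
      proof (cases "h 1 < 0")
        case True
        have "h u < 0" if "u \<in> {0..1}" for u
          using i[of u 1] neg[of u] True that by (cases "u = 1"; cases "u \<le> z") auto
        then show ?thesis by (simp add: single_crossing_def)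
      next
        case F: False
        then obtain z' where z': "z \<le> z'" "z' \<le> 1" "h z' = 0"
          using IVT'[of h z 0 1] cont neg[of z] cross by auto
        have "- h u > 0" if "u \<in> {0..<z'}" for u
          using neg[of u] i[of u z'] z' that by (cases "u \<le> z") auto
        moreover have "- h u < 0" if "u \<in> {z'<..1}" for u
          using i[of z' u] z' that by auto
        ultimately have "single_crossing (\<lambda>u. - h u)" unfolding single_crossing_def
          using z' cross by (intro disjI2 bexI[of _ z']) auto
        then show ?thesis ..
      qed
    qed
  qed
qed

lemma F_single_crossing:
  assumes "y > 0"
  shows "single_crossing (F y k) \<or> single_crossing (\<lambda>u. - F y k u)"
proof (induction k)
  case 0
  show ?case by (simp add: single_crossing_def)
next
  case (Suc k)
  then show ?case
  proof
    assume "single_crossing (F y k)"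
    from single_crossing_step[OF F_has_derivative assms F_Suc_0 this] show ?thesis .
  next
    assume *: "single_crossing (\<lambda>u. - F y k u)"
    have "((\<lambda>u. - F y (Suc k) u) has_real_derivative - y * - F y k u) (at u)" for u
      by (rule DERIV_cong[OF DERIV_minus[OF F_has_derivative]]) simp
    from single_crossing_step[OF this assms _ *] F_Suc_0 show ?thesis by auto
  qed
qed

text \<open>A zero at the right end must be the crossing point, so the sign is constant before it;
  the delay equation then moves \<open>K\<close> from 0 strictly to the other side during the next
  unit.\<close>

lemma F_sign_before_root:
  assumes "y > 0" "F y k 1 = 0"
  obtains \<sigma> :: real where "\<sigma> \<in> {1, -1}" "\<And>u. 0 \<le> u \<Longrightarrow> u < 1 \<Longrightarrow> \<sigma> * F y k u > 0"
    "\<sigma> * F y (Suc k) 1 < 0"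
proof -
  have "\<exists>\<sigma>\<in>{1, -1}. \<forall>u. 0 \<le> u \<and> u < 1 \<longrightarrow> \<sigma> * F y k u > 0"
  proof -
    have aux: "\<forall>u. 0 \<le> u \<and> u < 1 \<longrightarrow> g u > 0" if "single_crossing g" "g 1 = 0" for g
      using that unfolding single_crossing_def
      by (metis atLeastAtMost_iff atLeastLessThan_iff greaterThanAtMost_iff less_irrefl
          linorder_le_less_linear nle_le order_le_less zero_le_one)
    show ?thesis
      using F_single_crossing[OF assms(1), of k] aux[of "F y k"] aux[of "\<lambda>u. - F y k u"] assms(2)
      by auto
  qed
  then obtain \<sigma> :: real where s: "\<sigma> \<in> {1, -1}" "\<And>u. 0 \<le> u \<Longrightarrow> u < 1 \<Longrightarrow> \<sigma> * F y k u > 0"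
    by blast
  have "((\<lambda>u. \<sigma> * F y (Suc k) u) has_real_derivative - y * (\<sigma> * F y k u)) (at u)" for u
    by (rule DERIV_cong[OF DERIV_cmult[OF F_has_derivative]]) simp
  from strict_decreasing_of_deriv[OF this assms(1), of 0 1] s(2)
  have "\<sigma> * F y (Suc k) 1 < 0"
    using assms(2) by (simp add: F_Suc_0)
  with s that show thesis by blast
qed

text \<open>The Sturm condition: \<open>F y k 1\<close> is the value at the left end of the interval
  that ends in the zero, so it has the sign before the zero, while one unit after the zero the sign
  is opposite.\<close>

lemma F_sturm:
  assumes "y > 0" "F y (Suc k) 1 = 0"
  shows "F y k 1 * F y (Suc (Suc k)) 1 < 0"
proof -
  from F_sign_before_root[OF assms] obtain \<sigma> :: real where
    s: "\<sigma> \<in> {1, -1}" "\<And>u. 0 \<le> u \<Longrightarrow> u < 1 \<Longrightarrow> \<sigma> * F y (Suc k) u > 0"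
    "\<sigma> * F y (Suc (Suc k)) 1 < 0" by metis
  have "\<sigma> * F y k 1 > 0" using s(2)[of 0] by (simp add: F_Suc_0)
  with s(1,3) show ?thesis by (auto simp: mult_less_0_iff)
qed

section \<open>Exponential solutions and the amplitude at a root\<close>

text \<open>
  The functional on the left is the adjoint pairing of the delay equation with the exponential
  solution, hence it is multiplied by \<open>exp l\<close> in each unit step.
\<close>

lemma F_exponential_pairing:
  fixes l :: complex
  assumes l: "l = - of_real y * exp (- l)"
  shows "of_real (F y k 1) - of_real y * integral {0..1} (\<lambda>u. of_real (F y k u) * exp (- l * of_real u))
    = exp (of_nat (Suc k) * l)"
proof -
  define I where "I k = integral {0..1} (\<lambda>u. of_real (F y k u) * exp (- l * of_real u))" for k
  have int: "(\<lambda>u. complex_of_real (F y k u) * exp (- l * of_real u)) integrable_on {0..1}" for k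
    by (intro integrable_continuous_real continuous_intros)
  have yl: "- l * exp l = of_real y"
  proof -
    have "- l * exp l = of_real y * (exp (- l) * exp l)"
      by (subst (1) l) simp
    then show ?thesis by (simp flip: exp_add)
  qed
  have base: "- l * I 0 = exp (- l) - 1"
  proof -
    have "((\<lambda>u. - l * exp (- l * of_real u)) has_integral
        exp (- l * of_real 1) - exp (- l * of_real 0)) {0..1}"
      by (rule fundamental_theorem_of_calculus)
        (auto intro!: derivative_eq_intros has_vector_derivative_real_field)
    from integral_unique[OF this] show ?thesis by (simp add: I_def)
  qed
  \<comment> \<open>Fundamental theorem of calculus for the product of \<open>F y (Suc k) u\<close>
    and \<open>exp (- l * u)\<close>, whose value at \<open>u = 0\<close> is
    \<open>F y k 1\<close>.\<close>
  have step: "- of_real y * I k - l * I (Suc k) = of_real (F y (Suc k) 1) * exp (- l) - of_real (F y k 1)" for k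
  proof -
    have "((\<lambda>u. - of_real y * (of_real (F y k u) * exp (- l * of_real u))
              - l * (of_real (F y (Suc k) u) * exp (- l * of_real u))) has_integral
        of_real (F y (Suc k) 1) * exp (- l * of_real 1) - of_real (F y (Suc k) 0) * exp (- l * of_real 0)) {0..1}"
    proof (rule fundamental_theorem_of_calculus)
      fix u :: real
      have d1: "((\<lambda>u. complex_of_real (F y (Suc k) u)) has_vector_derivative of_real (- y * F y k u))
          (at u within {0..1})"
        using F_has_derivative[of y k u "{0..1}"]
        by (intro has_vector_derivative_of_real) (simp add: has_real_derivative_iff_has_vector_derivative)
      have d2: "((\<lambda>u. exp (- l * of_real u)) has_vector_derivative - l * exp (- l * of_real u))
          (at u within {0..1})"
        by (auto intro!: derivative_eq_intros has_vector_derivative_real_field)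
      show "((\<lambda>u. of_real (F y (Suc k) u) * exp (- l * of_real u)) has_vector_derivative
          - of_real y * (of_real (F y k u) * exp (- l * of_real u))
              - l * (of_real (F y (Suc k) u) * exp (- l * of_real u))) (at u within {0..1})"
        by (rule has_vector_derivative_eq_rhs[OF has_vector_derivative_mult[OF d1 d2]])
          (simp add: algebra_simps)
    qed simp
    from has_integral_unique[OF has_integral_diff[OF
        has_integral_mult_right[OF integrable_integral[OF int[of k]], of "- of_real y"]
        has_integral_mult_right[OF integrable_integral[OF int[of "Suc k"]], of l]] this]
    show ?thesis by (simp add: I_def F_Suc_0)
  qed
  have "of_real (F y k 1) - of_real y * I k = exp (of_nat (Suc k) * l)"
  proof (induction k)
    case 0
    have "of_real y * I 0 = exp l * (- l * I 0)"
      by (simp flip: yl add: mult_ac)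
    then show ?case unfolding base by (simp add: algebra_simps flip: exp_add)
  next
    case (Suc k)
    have "of_real y * I (Suc k) = exp l * (- l * I (Suc k))"
      by (simp flip: yl add: mult_ac)
    also have "- l * I (Suc k) = of_real (F y (Suc k) 1) * exp (- l) - of_real (F y k 1) + of_real y * I k"
      using step[of k] by (simp add: algebra_simps)
    also have "exp l * \<dots> = of_real (F y (Suc k) 1) * (exp l * exp (- l)) - exp l * (of_real (F y k 1) - of_real y * I k)"
      by (simp add: algebra_simps)
    also have "exp l * exp (- l) = 1" by (simp flip: exp_add)
    finally have "of_real y * I (Suc k) = of_real (F y (Suc k) 1) - exp l * exp (of_nat (Suc k) * l)"
      unfolding Suc.IH by simp
    moreover have "exp (of_nat (Suc (Suc k)) * l) = exp l * exp (of_nat (Suc k) * l)"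
      by (simp add: algebra_simps flip: exp_add)
    ultimately show ?case by simp
  qed
  then show ?thesis unfolding I_def .
qed

text \<open>At a root the pairing reduces to its integral. Since \<open>F y k\<close> has constant
  sign there, the modulus is at most the maximum of \<open>exp (- Re l * u)\<close> on the unit
  interval times the integral of \<open>y * \<bar>F y k u\<bar>\<close>, and that integral is
  \<open>\<bar>F y (Suc k) 1\<bar>\<close> by the delay equation.\<close>

lemma F_amplitude:
  fixes l :: complex
  assumes l: "l = - of_real y * exp (- l)" and y: "y > 0" and root: "F y k 1 = 0"
  shows "exp (real (Suc k) * Re l) \<le> max 1 (exp (- Re l)) * \<bar>F y (Suc k) 1\<bar>"
proof -
  from F_sign_before_root[OF y root] obtain \<sigma> :: real where
    s: "\<sigma> \<in> {1, -1}" "\<And>u. 0 \<le> u \<Longrightarrow> u < 1 \<Longrightarrow> \<sigma> * F y k u > 0"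
    "\<sigma> * F y (Suc k) 1 < 0" by metis
  define M where "M = max 1 (exp (- Re l))"
  have abs: "\<bar>F y k u\<bar> = \<sigma> * F y k u" if "u \<in> {0..1}" for u
    using s(1) s(2)[of u] root that by (cases "u = 1") auto
  have "((\<lambda>u. - y * F y k u) has_integral F y (Suc k) 1 - F y (Suc k) 0) {0..1}"
    by (rule fundamental_theorem_of_calculus)
      (use F_has_derivative in \<open>auto simp: has_real_derivative_iff_has_vector_derivative\<close>)
  from has_integral_mult_right[OF this, of "- \<sigma> * M"] have hi: "((\<lambda>u. y * M * (\<sigma> * F y k u)) has_integral M * \<bar>F y (Suc k) 1\<bar>) {0..1}"
    using s(1,3) by (auto simp: algebra_simps abs_if F_Suc_0 root)
  have "exp (real (Suc k) * Re l) = norm (exp (of_nat (Suc k) * l))"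
    by (simp add: algebra_simps)
  also have "\<dots> = norm (integral {0..1} (\<lambda>u. of_real y * (of_real (F y k u) * exp (- l * of_real u))))"
  proof -
    have "exp (of_nat (Suc k) * l)
        = - integral {0..1} (\<lambda>u. of_real y * (of_real (F y k u) * exp (- l * of_real u)))"
      using F_exponential_pairing[OF l, of k] root by simp
    then show ?thesis by (simp only: norm_minus_cancel)
  qed
  also have "\<dots> \<le> integral {0..1} (\<lambda>u. y * M * (\<sigma> * F y k u))"
  proof (rule integral_norm_bound_integral)
    fix u :: real assume u: "u \<in> {0..1}"
    have "- Re l * u \<le> max 0 (- Re l)"
      using u by (cases "Re l \<ge> 0") (auto simp: mult_nonneg_nonneg max_def mult_left_le mult_le_0_iff)
    then have "exp (- Re l * u) \<le> M"
      unfolding M_def by (smt (verit) exp_le_cancel_iff exp_zero)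
    then have "y * \<bar>F y k u\<bar> * exp (- Re l * u) \<le> y * \<bar>F y k u\<bar> * M"
      using y by (intro mult_left_mono) auto
    then show "norm (of_real y * (of_real (F y k u) * exp (- l * of_real u))) \<le> y * M * (\<sigma> * F y k u)"
      using y abs[OF u] by (simp add: norm_mult algebra_simps)
  qed (use hi in \<open>auto intro!: integrable_continuous_real continuous_intros\<close>)
  also have "\<dots> = M * \<bar>F y (Suc k) 1\<bar>"
    using hi by (rule integral_unique)
  finally show ?thesis unfolding M_def .
qed

section \<open>Real-rootedness of the delay polynomials\<close>

text \<open>Stated over an arbitrary field because it serves both the real delay polynomials and the
  final complex polynomial.\<close>

lemma poly_eq_prod_roots:
  fixes p :: "'a :: field poly"
  assumes "finite A" "\<And>a. a \<in> A \<Longrightarrow> poly p a = 0" "card A = degree p"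
  shows "p = smult (lead_coeff p) (\<Prod>a\<in>A. [:- a, 1:])"
  using assms
proof (induction A arbitrary: p rule: finite_induct)
  case empty
  then obtain c where "p = [:c:]" by (metis card.empty degree_eq_zeroE)
  then show ?case by simp
next
  case (insert a A)
  then have "[:- a, 1:] dvd p" by (simp add: poly_eq_0_iff_dvd)
  then obtain q where q: "p = [:- a, 1:] * q" by blast
  have "p \<noteq> 0" using insert by auto
  then have "q \<noteq> 0" using q by auto
  then have "degree p = Suc (degree q)" unfolding q by (subst degree_mult_eq) auto
  moreover have "poly q b = 0" if "b \<in> A" for b
    using insert.prems(1)[of b] insert.hyps that unfolding q by auto
  ultimately have "q = smult (lead_coeff q) (\<Prod>a\<in>A. [:- a, 1:])"
    using insert by (intro insert.IH) auto
  moreover have "lead_coeff p = lead_coeff q"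
    unfolding q by (subst lead_coeff_mult) simp
  ultimately show ?case
    using insert.hyps q by (metis mult_smult_right prod.insert)
qed

lemma sign_changes_imp_roots:
  fixes g :: "real \<Rightarrow> real"
  assumes "continuous_on UNIV g" "\<And>i. i < r \<Longrightarrow> Z i < Z (Suc i)"
    and "\<And>i. i \<le> r \<Longrightarrow> (-1) ^ i * g (Z i) > 0"
  obtains R where "\<And>i. i < r \<Longrightarrow> Z i < R i" "\<And>i. i < r \<Longrightarrow> R i < Z (Suc i)"
    "\<And>i. i < r \<Longrightarrow> g (R i) = 0"
proof -
  have "\<exists>x. Z i < x \<and> x < Z (Suc i) \<and> g x = 0" if i: "i < r" for i
  proof -
    let ?h = "\<lambda>x. (-1) ^ i * g x"
    have "?h (Z i) > 0" "?h (Z (Suc i)) < 0"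
      using assms(3)[of i] assms(3)[of "Suc i"] i by auto
    moreover have "continuous_on {Z i..Z (Suc i)} ?h"
      using assms(1) by (intro continuous_intros continuous_on_subset[OF assms(1)]) auto
    ultimately obtain x where "Z i \<le> x" "x \<le> Z (Suc i)" "?h x = 0"
      using IVT2'[of ?h "Z (Suc i)" 0 "Z i"] assms(2)[OF i] by auto
    moreover from this have "x \<noteq> Z i" "x \<noteq> Z (Suc i)"
      using \<open>?h (Z i) > 0\<close> \<open>?h (Z (Suc i)) < 0\<close> by auto
    ultimately show ?thesis
      by (intro exI[of _ x]) simp
  qed
  then show thesis using that by metis
qed

text \<open>Supplies the last sign-change point, beyond any prescribed bound.\<close>

lemma poly_sign_at_minus_infinity:
  fixes p :: "real poly"
  assumes "lead_coeff p > 0"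
  obtains B where "B > b" "(-1) ^ degree p * poly p (- B) > 0"
proof -
  define q where "q = smult ((-1) ^ degree p) (pcompose p [:0, -1:])"
  have "lead_coeff q = lead_coeff p"
    by (simp add: q_def lead_coeff_comp flip: power_mult_distrib)
  then obtain m where m: "\<And>x. x \<ge> m \<Longrightarrow> poly q x \<ge> lead_coeff q" "lead_coeff q > 0"
    using poly_pinfty_gt_lc[of q] assms by auto
  have "poly q (max m (b + 1)) > 0"
    using m(1)[of "max m (b + 1)"] m(2) by linarith
  then show thesis
    by (intro that[of "max m (b + 1)"]) (auto simp: q_def poly_pcompose)
qed

lemma strict_mono_on_lessThan:
  fixes Y :: "nat \<Rightarrow> real"
  assumes "\<And>i. Suc i < k \<Longrightarrow> Y i < Y (Suc i)"
  shows "strict_mono_on {..<k} Y"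
proof (rule strict_mono_onI)
  fix i j assume "i \<in> {..<k}" "j \<in> {..<k}" "i < j"
  then show "Y i < Y j"
  proof (induction j)
    case (Suc j)
    show ?case
    proof (cases "i = j")
      case False
      then have "Y i < Y j" using Suc by auto
      then show ?thesis using assms(1)[of j] Suc by auto
    qed (use assms(1) Suc in auto)
  qed auto
qed

section \<open>The delay polynomials and the interlacing of their roots\<close>

text \<open>The value \<open>K (n + 1)\<close> as a polynomial in \<open>\<zeta> = - y\<close>; in
  this variable all coefficients up to degree \<open>n\<close> are positive.\<close>

definition fpoly :: "nat \<Rightarrow> real poly" where
  "fpoly n = (\<Sum>i\<le>n. monom (real (n - i + 1) ^ i / fact i) i)"

lemma poly_fpoly: "poly (fpoly n) (- y) = F y n 1"
  by (simp add: fpoly_def F_def poly_sum poly_monom algebra_simps)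

lemma coeff_fpoly: "coeff (fpoly n) i = (if i \<le> n then real (n - i + 1) ^ i / fact i else 0)"
  by (simp add: fpoly_def coeff_sum)

lemma degree_fpoly [simp]: "degree (fpoly n) = n"
  by (rule antisym; intro degree_le le_degree) (auto simp: coeff_fpoly)

lemma lead_coeff_fpoly: "lead_coeff (fpoly n) > 0"
  by (simp add: coeff_fpoly)

lemma fpoly_eq_prod:
  assumes "\<And>i. i < n \<Longrightarrow> F (Y i) n 1 = 0" "strict_mono_on {..<n} Y"
  shows "fpoly n = smult (lead_coeff (fpoly n)) (\<Prod>i<n. [:Y i, 1:])"
proof -
  have inj: "inj_on (\<lambda>i. - Y i) {..<n}"
    using strict_mono_on_imp_inj_on[OF assms(2)] by (auto simp: inj_on_def)
  have "fpoly n = smult (lead_coeff (fpoly n)) (\<Prod>a\<in>(\<lambda>i. - Y i) ` {..<n}. [:- a, 1:])"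
    by (rule poly_eq_prod_roots) (use assms in \<open>auto simp: poly_fpoly card_image[OF inj]\<close>)
  then show ?thesis by (simp add: prod.reindex[OF inj])
qed

text \<open>The constant factor is fixed by \<open>F 0 n 1 = 1\<close>.\<close>

lemma F_eq_prod:
  assumes "\<And>i. i < n \<Longrightarrow> F (Y i) n 1 = 0" "strict_mono_on {..<n} Y"
    and pos: "\<And>i. i < n \<Longrightarrow> Y i > 0"
  shows "F y n 1 = (\<Prod>i<n. 1 - y / Y i)"
proof -
  define c where "c = lead_coeff (fpoly n)"
  have *: "F y n 1 = c * (\<Prod>i<n. Y i - y)" for y
    by (subst poly_fpoly [symmetric], subst fpoly_eq_prod[of n Y, OF assms(1,2)])
      (simp_all add: poly_prod c_def)
  have "c * (\<Prod>i<n. Y i) = 1" using *[of 0] by simp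
  moreover have "(\<Prod>i<n. Y i - y) = (\<Prod>i<n. Y i) * (\<Prod>i<n. 1 - y / Y i)"
    unfolding prod.distrib[symmetric] by (intro prod.cong) (use pos in \<open>force simp: field_simps\<close>)+
  ultimately show ?thesis unfolding * by (simp flip: mult.assoc)
qed

text \<open>Exactly the first \<open>i\<close> factors are negative.\<close>

lemma prod_sign:
  fixes Y :: "nat \<Rightarrow> real"
  assumes "\<And>l. l < n \<Longrightarrow> Y l > 0" "i \<le> n" "\<And>l. l < i \<Longrightarrow> Y l < y"
    and "\<And>l. i \<le> l \<Longrightarrow> l < n \<Longrightarrow> y < Y l"
  shows "(-1) ^ i * (\<Prod>l<n. 1 - y / Y l) > 0"
proof -
  have "(-1) ^ i * (\<Prod>l<i. 1 - y / Y l) = (\<Prod>l<i. y / Y l - 1)"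
    using prod.distrib[of "\<lambda>_. -1" "\<lambda>l. 1 - y / Y l" "{..<i}"] by simp
  also have "\<dots> > 0"
    using assms by (intro prod_pos) (auto simp: field_simps)
  finally have "(-1) ^ i * (\<Prod>l<i. 1 - y / Y l) > 0" .
  moreover have "(\<Prod>l=i..<n. 1 - y / Y l) > 0"
    using assms by (intro prod_pos) (auto simp: field_simps)
  moreover have "(\<Prod>l<n. 1 - y / Y l) = (\<Prod>l<i. 1 - y / Y l) * (\<Prod>l=i..<n. 1 - y / Y l)"
    using prod.atLeastLessThan_concat[of 0 i n "\<lambda>l. 1 - y / Y l"] assms(2) by (simp add: atLeast0LessThan)
  ultimately show ?thesis by (simp flip: mult.assoc)
qed

text \<open>Sturm induction. The alternating signs at the old roots, together with the value 1 at
  \<open>y = 0\<close> and the sign far out, give one new root in each gap. The product formula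
  gives the sign of \<open>F _ k 1\<close> at the new roots, and \<open>F_sturm\<close> carries it
  over, reversed, to \<open>F _ (Suc (Suc k)) 1\<close>.\<close>

lemma F_roots:
  obtains Y where "\<And>i. i < k \<Longrightarrow> Y i > 0" "\<And>i. i < k \<Longrightarrow> F (Y i) k 1 = 0"
    "strict_mono_on {..<k} Y" "\<And>i. i < k \<Longrightarrow> (-1) ^ i * F (Y i) (Suc k) 1 < 0"
proof -
  have "\<exists>Y. (\<forall>i<k. Y i > 0 \<and> F (Y i) k 1 = 0 \<and> (-1) ^ i * F (Y i) (Suc k) 1 < 0) \<and>
      strict_mono_on {..<k} Y"
  proof (induction k)
    case (Suc k)
    then obtain Y where Y: "\<And>i. i < k \<Longrightarrow> Y i > 0" "\<And>i. i < k \<Longrightarrow> F (Y i) k 1 = 0"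
      "strict_mono_on {..<k} Y" "\<And>i. i < k \<Longrightarrow> (-1) ^ i * F (Y i) (Suc k) 1 < 0"
      by blast
    \<comment> \<open>\<open>B\<close> lies beyond the largest old root, or beyond 0 if there is
      none.\<close>
    obtain B where B: "B > (if k = 0 then 0 else Y (k - 1))" "(-1) ^ Suc k * F B (Suc k) 1 > 0"
      using poly_sign_at_minus_infinity[OF lead_coeff_fpoly[of "Suc k"]]
      by (metis degree_fpoly poly_fpoly)
    define Z where "Z i = (if i = 0 then 0 else if i \<le> k then Y (i - 1) else B)" for i
    have "continuous_on UNIV (\<lambda>y. F y (Suc k) 1)"
      unfolding F_def by (intro continuous_intros) auto
    moreover have Zinc: "Z i < Z (Suc i)" if "i < Suc k" for i
      using that B(1) Y(1)[of 0] Y(1)[of "k - 1"] strict_mono_onD[OF Y(3), of "i - 1" i]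
      by (cases "i = k"; cases i) (auto simp: Z_def split: if_splits)
    moreover have "(-1) ^ i * F (Z i) (Suc k) 1 > 0" if i: "i \<le> Suc k" for i
    proof -
      consider "i = 0" | l where "i = Suc l" "l < k" | "i = Suc k"
        using i by (cases i) (auto simp: le_less)
      then show ?thesis
        by cases (use B(2) Y(4) in \<open>auto simp: Z_def\<close>)
    qed
    ultimately obtain R where R: "\<And>i. i < Suc k \<Longrightarrow> Z i < R i" "\<And>i. i < Suc k \<Longrightarrow> R i < Z (Suc i)"
      "\<And>i. i < Suc k \<Longrightarrow> F (R i) (Suc k) 1 = 0"
      using sign_changes_imp_roots[of "\<lambda>y. F y (Suc k) 1" "Suc k" Z] by metis
    have "strict_mono_on {..<Suc (Suc k)} Z" using Zinc by (intro strict_mono_on_lessThan) auto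
    then have Zmono: "Z i \<le> Z j" if "i \<le> j" "j < Suc (Suc k)" for i j
      using strict_mono_onD[of "{..<Suc (Suc k)}" Z i j] that by (cases "i = j") auto
    have pos: "R i > 0" if "i < Suc k" for i
      using R(1)[OF that] Zmono[of 0 i] that by (simp add: Z_def)
    have "(-1) ^ i * F (R i) (Suc (Suc k)) 1 < 0" if i: "i < Suc k" for i
    proof -
      \<comment> \<open>Interlacing: exactly the \<open>i\<close> old roots
        \<open>Y 0, ..., Y (i - 1)\<close> lie below \<open>R i\<close>.\<close>
      have below: "Y l < R i" if "l < i" for l
        using R(1)[OF i] Zmono[of "Suc l" i] that i by (simp add: Z_def)
      have above: "R i < Y l" if "i \<le> l" "l < k" for l
        using R(2)[OF i] Zmono[of "Suc i" "Suc l"] that i by (simp add: Z_def)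
      have "(-1) ^ i * (\<Prod>l<k. 1 - R i / Y l) > 0"
        by (rule prod_sign) (use Y(1) i below above in auto)
      then have "(-1) ^ i * F (R i) k 1 > 0"
        by (simp add: F_eq_prod[of k Y, OF Y(2,3,1)])
      moreover have "F (R i) k 1 * F (R i) (Suc (Suc k)) 1 < 0"
        by (rule F_sturm) (use pos R(3) i in auto)
      ultimately show ?thesis
        by (cases "even i") (auto simp: mult_less_0_iff)
    qed
    moreover have "R i < R (Suc i)" if "Suc i < Suc k" for i
      using R(2)[of i] R(1)[of "Suc i"] that by auto
    then have "strict_mono_on {..<Suc k} R" by (rule strict_mono_on_lessThan)
    ultimately show ?case using pos R(3) by (intro exI[of _ R]) auto
  qed auto
  then show thesis using that by blast
qed

section \<open>Bounds for the second and third largest roots from coefficients\<close>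

lemma coeff_linear_mult:
  "coeff ([:a, 1:] * q) k = a * coeff q k + (if k = 0 then 0 else coeff q (k - 1))"
  for a :: "'a :: comm_semiring_1"
  by (cases k) auto

lemma coeff_prod_linear_nonneg:
  fixes Y :: "nat \<Rightarrow> real"
  assumes "\<And>i. i < n \<Longrightarrow> Y i \<ge> 0"
  shows "coeff (\<Prod>i<n. [:Y i, 1:]) k \<ge> 0"
  using assms
proof (induction n arbitrary: k)
  case (Suc n)
  then have "\<And>k. coeff (\<Prod>i<n. [:Y i, 1:]) k \<ge> 0" "Y n \<ge> 0" by auto
  then have "coeff ([:Y n, 1:] * (\<Prod>i<n. [:Y i, 1:])) k \<ge> 0"
    unfolding coeff_linear_mult by auto
  then show ?case by (simp only: prod.lessThan_Suc mult.commute)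
qed (auto simp: coeff_1)

lemma degree_prod_linear: "degree (\<Prod>i<n. [:Y i, 1:]) \<le> n" for Y :: "nat \<Rightarrow> real"
  using degree_prod_sum_le[of "{..<n}" "\<lambda>i. [:Y i, 1:]"] by simp

text \<open>Let \<open>b\<close> be the second largest root. Every root pairs with one of the two
  largest, and every pair arises from at most two roots, so \<open>b * e1 <= 2 * e2\<close> for the
  elementary symmetric functions.\<close>

lemma second_root_le:
  fixes R :: "real poly"
  assumes p: "p = [:a, 1:] * ([:b, 1:] * R)" and "0 \<le> b" "b \<le> a"
    and nonneg: "\<And>k. coeff R k \<ge> 0" and deg: "degree R \<le> d"
  shows "b * coeff p (Suc d) \<le> 2 * coeff p d"
proof -
  \<comment> \<open>In the application \<open>x j\<close> is a positive constant times the
    \<open>j\<close>-th elementary symmetric function of the remaining roots; the default 0 beyond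
    \<open>d\<close> covers small \<open>d\<close>.\<close>
  define x where "x j = (if j \<le> d then coeff R (d - j) else 0)" for j
  have x: "x j \<ge> 0" for j using nonneg by (simp add: x_def)
  have "coeff R (Suc d) = 0" using deg by (simp add: coeff_eq_0)
  then have "coeff p (Suc d) = (a + b) * x 0 + x 1"
    by (cases d) (auto simp: p coeff_linear_mult x_def algebra_simps)
  moreover have "coeff p d = a * b * x 0 + (a + b) * x 1 + x 2"
    by (cases d; cases "d - 1") (auto simp: p coeff_linear_mult x_def algebra_simps numeral_2_eq_2)
  moreover have "b * ((a + b) * x 0 + x 1) \<le> 2 * (a * b * x 0 + (a + b) * x 1 + x 2)"
  proof -
    have "b * b \<le> a * b" using assms(2,3) by (rule mult_right_mono[rotated])
    then have "b * (a + b) * x 0 \<le> 2 * (a * b) * x 0"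
      using x by (intro mult_right_mono) (auto simp: algebra_simps)
    moreover have "b * x 1 \<le> 2 * (a + b) * x 1"
      using assms(2,3) x by (intro mult_right_mono) auto
    ultimately show ?thesis using x[of 2] by (simp add: algebra_simps)
  qed
  ultimately show ?thesis by simp
qed

text \<open>
  If \<open>c\<close> is the third largest root, every pair of roots extends by one of the three largest to a
  triple, and every triple arises from at most three pairs, so \<open>c * e\<^sub>2 \<le> 3 * e\<^sub>3\<close> for the
  elementary symmetric functions of the roots.
\<close>

lemma third_root_le:
  fixes R :: "real poly"
  assumes p: "p = [:a, 1:] * ([:b, 1:] * ([:c, 1:] * R))" and c: "0 \<le> c" "c \<le> b" "b \<le> a"
    and nonneg: "\<And>k. coeff R k \<ge> 0" and deg: "degree R \<le> d"
  shows "c * coeff p (Suc d) \<le> 3 * coeff p d"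
proof -
  define x where "x j = (if j \<le> d then coeff R (d - j) else 0)" for j
  define s where "s = a + b + c"
  define t where "t = a * b + a * c + b * c"
  have x: "x j \<ge> 0" for j using nonneg by (simp add: x_def)
  have R: "coeff R (Suc d) = 0" using deg by (simp add: coeff_eq_0)
  then have "coeff p (Suc d) = t * x 0 + s * x 1 + x 2"
    by (cases d; cases "d - 1")
      (auto simp: p coeff_linear_mult x_def s_def t_def algebra_simps numeral_2_eq_2)
  moreover have "coeff p d = a * b * c * x 0 + t * x 1 + s * x 2 + x 3"
    by (cases d; cases "d - 1"; cases "d - 2")
      (auto simp: p coeff_linear_mult x_def s_def t_def algebra_simps numeral_2_eq_2 numeral_3_eq_3)
  moreover have "c * (t * x 0 + s * x 1 + x 2) \<le> 3 * (a * b * c * x 0 + t * x 1 + s * x 2 + x 3)"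
  proof -
    have m: "a * c \<le> a * b" "b * c \<le> b * a" "c * c \<le> c * a" "0 \<le> a * b" "0 \<le> b * c" "0 \<le> a * c"
      using c by (auto intro!: mult_mono)
    have "c * t \<le> c * (3 * (a * b))"
      unfolding t_def using c m by (intro mult_left_mono) (auto simp: algebra_simps)
    then have "c * t * x 0 \<le> c * (3 * (a * b)) * x 0"
      using x by (rule mult_right_mono)
    moreover have "c * s * x 1 \<le> 3 * t * x 1"
      unfolding s_def t_def using c m x
      by (intro mult_right_mono) (auto simp: algebra_simps intro: order.trans[OF m(3)])
    moreover have "c * x 2 \<le> 3 * s * x 2"
      unfolding s_def using c x by (intro mult_right_mono) auto
    ultimately show ?thesis using x[of 3] by (simp add: algebra_simps)
  qed
  ultimately show ?thesis by simp
qed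

text \<open>Roots are listed in increasing order, so \<open>Y d\<close> is the second largest of
  \<open>d + 2\<close>. The bound is twice the quotient of the coefficients
  \<open>3 ^ d / fact d\<close> and \<open>2 ^ Suc d / fact (Suc d)\<close>.\<close>

lemma F_second_largest_root:
  assumes "\<And>i. i < d + 2 \<Longrightarrow> F (Y i) (d + 2) 1 = 0" "strict_mono_on {..<d + 2} Y"
    and pos: "\<And>i. i < d + 2 \<Longrightarrow> Y i > 0"
  shows "Y d \<le> real (d + 1) * (3 / 2) ^ d"
proof -
  define R where "R = smult (lead_coeff (fpoly (d + 2))) (\<Prod>i<d. [:Y i, 1:])"
  have p: "fpoly (d + 2) = [:Y (Suc d), 1:] * ([:Y d, 1:] * R)"
    unfolding R_def mult_smult_right
    by (subst fpoly_eq_prod[of "d + 2" Y, OF assms(1,2)])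
      (simp_all only: numeral_2_eq_2 add_Suc_right add_0_right prod.lessThan_Suc mult_ac)
  have "coeff R k \<ge> 0" for k
    unfolding R_def coeff_smult using lead_coeff_fpoly
    by (intro mult_nonneg_nonneg coeff_prod_linear_nonneg) (auto simp: less_imp_le pos)
  moreover have "degree R \<le> d"
    unfolding R_def by (rule order.trans[OF degree_smult_le degree_prod_linear])
  moreover have "0 \<le> Y d" "Y d \<le> Y (Suc d)"
    using pos[of d] strict_mono_onD[OF assms(2), of d "Suc d"] by auto
  ultimately have "Y d * coeff (fpoly (d + 2)) (Suc d) \<le> 2 * coeff (fpoly (d + 2)) d"
    using p by (intro second_root_le)
  then have le: "Y d * (2 ^ Suc d / fact (Suc d)) \<le> 2 * (3 ^ d / fact d)"
    by (simp add: coeff_fpoly)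
  have "Y d * 2 ^ d = Y d * (2 ^ Suc d / fact (Suc d)) * (fact (Suc d) / 2)"
    by (simp del: fact_Suc)
  also have "\<dots> \<le> 2 * (3 ^ d / fact d) * (fact (Suc d) / 2)"
    using le by (rule mult_right_mono) simp
  also have "\<dots> = real (d + 1) * 3 ^ d"
    by (simp add: field_simps)
  finally show ?thesis by (simp add: field_simps power_divide)
qed

text \<open>Three times the quotient of the coefficients \<open>4 ^ d / fact d\<close> and
  \<open>3 ^ Suc d / fact (Suc d)\<close>.\<close>

lemma F_third_largest_root:
  assumes "\<And>i. i < d + 3 \<Longrightarrow> F (Y i) (d + 3) 1 = 0" "strict_mono_on {..<d + 3} Y"
    and pos: "\<And>i. i < d + 3 \<Longrightarrow> Y i > 0"
  shows "Y d \<le> real (d + 1) * (4 / 3) ^ d"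
proof -
  define R where "R = smult (lead_coeff (fpoly (d + 3))) (\<Prod>i<d. [:Y i, 1:])"
  have p: "fpoly (d + 3) = [:Y (Suc (Suc d)), 1:] * ([:Y (Suc d), 1:] * ([:Y d, 1:] * R))"
    unfolding R_def mult_smult_right
    by (subst fpoly_eq_prod[of "d + 3" Y, OF assms(1,2)])
      (simp_all only: numeral_3_eq_3 add_Suc_right add_0_right prod.lessThan_Suc mult_ac)
  have "coeff R k \<ge> 0" for k
    unfolding R_def coeff_smult using lead_coeff_fpoly
    by (intro mult_nonneg_nonneg coeff_prod_linear_nonneg) (auto simp: less_imp_le pos)
  moreover have "degree R \<le> d"
    unfolding R_def by (rule order.trans[OF degree_smult_le degree_prod_linear])
  moreover have "0 \<le> Y d" "Y d \<le> Y (Suc d)" "Y (Suc d) \<le> Y (Suc (Suc d))"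
    using pos[of d] strict_mono_onD[OF assms(2), of d "Suc d"] strict_mono_onD[OF assms(2), of "Suc d" "Suc (Suc d)"] by auto
  ultimately have "Y d * coeff (fpoly (d + 3)) (Suc d) \<le> 3 * coeff (fpoly (d + 3)) d"
    using p by (intro third_root_le)
  then have le: "Y d * (3 ^ Suc d / fact (Suc d)) \<le> 3 * (4 ^ d / fact d)"
    by (simp add: coeff_fpoly)
  have "Y d * 3 ^ d = Y d * (3 ^ Suc d / fact (Suc d)) * (fact (Suc d) / 3)"
    by (simp del: fact_Suc)
  also have "\<dots> \<le> 3 * (4 ^ d / fact d) * (fact (Suc d) / 3)"
    using le by (rule mult_right_mono) simp
  also have "\<dots> = real (d + 1) * 4 ^ d"
    by (simp add: field_simps)
  finally show ?thesis by (simp add: field_simps power_divide)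
qed

section \<open>A lower bound for the amplitude\<close>

text \<open>From \<open>n\<close> to \<open>n + 1\<close> the left side grows by the factor
  \<open>(n + 1) / e * (1 + 1 / (n + 1)) ^ (n + 1)\<close>, which is at most
  \<open>n + 1\<close>.\<close>

lemma fact_ge: "(real (n + 1) / exp 1) ^ n \<le> fact n"
proof (induction n)
  case (Suc n)
  have "1 + 1 / real (n + 1) = real (Suc n + 1) / real (n + 1)" by (simp add: field_simps)
  then have "(real (Suc n + 1) / exp 1) ^ Suc n
      = (real (n + 1) / exp 1) ^ Suc n * (1 + 1 / real (n + 1)) ^ Suc n"
    by (simp flip: power_mult_distrib del: power_Suc of_nat_Suc)
  also have "\<dots> \<le> (real (n + 1) / exp 1) ^ Suc n * exp 1"
    using exp_ge_one_plus_x_over_n_power_n[of "Suc n" 1] by (intro mult_left_mono) (auto simp: add.commute)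
  also have "\<dots> = real (n + 1) * (real (n + 1) / exp 1) ^ n" by simp
  also have "\<dots> \<le> real (n + 1) * fact n"
    using Suc by (intro mult_left_mono) auto
  finally show ?case by simp
qed simp

lemma sin_ge_cubic: "x - x ^ 3 / 6 \<le> sin x" if "0 \<le> x" for x :: real
proof -
  have "\<bar>sin x - (\<Sum>m<3. sin_coeff m * x ^ m)\<bar> \<le> inverse (fact 3) * \<bar>x\<bar> ^ 3"
    by (rule Maclaurin_sin_bound)
  moreover have "(\<Sum>m<3. sin_coeff m * x ^ m) = x"
    by (simp add: numeral_3_eq_3 sin_coeff_def)
  ultimately have "\<bar>sin x - x\<bar> \<le> x ^ 3 / 6" using that by (simp add: fact_numeral field_simps)
  then show ?thesis by linarith
qed

text \<open>Equality holds at \<open>pi / 4\<close>, and the right side minus the left is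
  nondecreasing. With \<open>x\<close> half the imaginary part of \<open>l\<close>, this bounds
  \<open>\<bar>l\<bar> - Re l\<close> by \<open>pi / 2\<close>.\<close>

lemma mul_cos_le_sin:
  assumes "pi / 4 \<le> x" "x \<le> pi / 2"
  shows "x * cos x \<le> pi / 4 * sin x"
proof -
  have "pi / 4 * sin (pi / 4) - pi / 4 * cos (pi / 4) \<le> pi / 4 * sin x - x * cos x"
  proof (rule DERIV_nonneg_imp_nondecreasing[OF assms(1)])
    fix t assume t: "pi / 4 \<le> t" "t \<le> x"
    have "cos t \<le> cos (pi / 4)" "sin (pi / 4) \<le> sin t" "cos t \<ge> 0"
      using t assms by (auto intro!: cos_monotone_0_pi_le sin_monotone_2pi_le cos_ge_zero)
    then have "cos t \<le> sin t" by (simp add: cos_45 sin_45)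
    moreover have "(1 - pi / 4) * cos t \<le> t * cos t"
      using t pi_gt3 \<open>cos t \<ge> 0\<close> by (intro mult_right_mono) auto
    moreover have "t * cos t \<le> t * sin t"
      using t pi_gt3 \<open>cos t \<le> sin t\<close> by (intro mult_left_mono) linarith+
    ultimately have "(1 - pi / 4) * cos t \<le> t * sin t" by linarith
    moreover have "((\<lambda>x. pi / 4 * sin x - x * cos x) has_real_derivative
        pi / 4 * cos t - (cos t - t * sin t)) (at t)"
      by (auto intro!: derivative_eq_intros)
    ultimately show "\<exists>y. ((\<lambda>x. pi / 4 * sin x - x * cos x) has_real_derivative y) (at t) \<and> 0 \<le> y"
      by (intro exI conjI) (auto simp: algebra_simps)
  qed
  then show ?thesis by (simp add: cos_45 sin_45)
qed

text \<open>
  The real and imaginary part of a solution \<open>l\<close> of \<open>l = - y * exp (- l)\<close> are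
  \<open>- b * cot b\<close> and \<open>b\<close>.
\<close>

lemma principal_angle:
  assumes y: "y > exp (- 1)"
  obtains b :: real where "0 < b" "b < pi" "y * sin b * exp (b * cos b / sin b) = b"
proof -
  define h where "h b = y * sin b * exp (b * cos b / sin b) - b" for b
  have y0: "y > 0" using y by (meson exp_gt_zero less_trans)
  \<comment> \<open>As \<open>b\<close> tends to 0, \<open>(h b + b) / b\<close> tends to
    \<open>y * exp 1 > 1\<close>, so \<open>h\<close> is positive near 0.\<close>
  have "((\<lambda>x. sin x / x) \<longlongrightarrow> 1) (at (0::real))"
    using DERIV_sin[of "0::real"] by (simp add: DERIV_def)
  then have "((\<lambda>x. y * (sin x / x) * exp (cos x / (sin x / x))) \<longlongrightarrow> y * 1 * exp (cos 0 / 1)) (at (0::real))"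
    by (intro tendsto_intros) auto
  moreover have "y * 1 * exp (cos 0 / 1) > 1"
  proof -
    have "exp (- 1) * exp 1 < y * exp (1::real)"
      using y by (intro mult_strict_right_mono) auto
    then show ?thesis by (simp flip: exp_add)
  qed
  ultimately have "\<forall>\<^sub>F x in at (0::real). y * (sin x / x) * exp (cos x / (sin x / x)) > 1"
    by (rule order_tendstoD)
  then have "\<forall>\<^sub>F x in at_right (0::real). y * (sin x / x) * exp (cos x / (sin x / x)) > 1"
    by (simp add: eventually_at_split)
  moreover have "\<forall>\<^sub>F x in at_right (0::real). x \<in> {0<..<1}"
    by (intro eventually_at_right_real) simp
  ultimately have "\<forall>\<^sub>F x in at_right (0::real). y * (sin x / x) * exp (cos x / (sin x / x)) > 1 \<and> x \<in> {0<..<1}"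
    by (rule eventually_conj)
  then obtain a where a: "y * (sin a / a) * exp (cos a / (sin a / a)) > 1" "0 < a" "a < 1"
    using eventually_happens'[of "at_right (0::real)"] trivial_limit_at_right_real by force
  then have ha: "h a > 0" by (simp add: h_def field_simps)
  \<comment> \<open>The term \<open>1 / y\<close> forces \<open>y * sin c \<le> 1\<close>; the
    minimum with 1 keeps \<open>c\<close> beyond \<open>pi / 2\<close>, so that the exponent in
    \<open>h c\<close> is not positive, and beyond 1, so that \<open>h c < 0\<close>.\<close>
  define c where "c = pi - min 1 (1 / y)"
  have c: "c < pi" "c \<ge> pi - 1" using y0 by (auto simp: c_def)
  have "cos c \<le> 0"
    using c pi_gt3 cos_monotone_0_pi_le[of "pi / 2" c] by auto
  have "sin c > 0" using c pi_gt3 by (intro sin_gt_zero) auto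
  have "y * sin c \<le> 1"
  proof -
    have "sin c = sin (min 1 (1 / y))" by (simp add: c_def)
    also have "\<dots> \<le> min 1 (1 / y)" using y0 by (intro sin_x_le_x) auto
    also have "\<dots> \<le> 1 / y" by simp
    finally show ?thesis using y0 by (simp add: field_simps)
  qed
  moreover have "c * cos c / sin c \<le> 0"
    using c pi_gt3 \<open>cos c \<le> 0\<close> \<open>sin c > 0\<close> by (auto simp: divide_le_0_iff mult_le_0_iff)
  then have "exp (c * cos c / sin c) \<le> 1" by simp
  ultimately have "y * sin c * exp (c * cos c / sin c) \<le> 1"
    using mult_le_one[of "y * sin c" "exp (c * cos c / sin c)"] by simp
  then have hc: "h c < 0" using c pi_gt3 by (simp add: h_def)
  have nz: "sin x \<noteq> 0" if "x \<in> {a..c}" for x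
  proof -
    have "sin x > 0" using that a c by (intro sin_gt_zero) auto
    then show ?thesis by simp
  qed
  have "continuous_on {a..c} h"
    unfolding h_def using nz by (intro continuous_intros) auto
  then obtain b where "a \<le> b" "b \<le> c" "h b = 0"
    using IVT2'[of h c 0 a] ha hc a c pi_gt3 by auto
  then show thesis using a c by (intro that[of b]) (auto simp: h_def)
qed

text \<open>
  With \<open>n = t + 4\<close> and \<open>s = 1 / exp 1\<close> this follows from \<open>3 / 4 * exp s \<ge> 1.0725\<close> and
  Bernoulli's inequality. The right-hand side is a lower bound for \<open>y\<close> if \<open>\<bar>l\<bar> ^ n \<ge> fact n\<close>.
\<close>

lemma power_4_3_bound:
  assumes "n \<ge> 5"
  shows "real (n - 3) * (4 / 3) ^ (n - 4) < real (n + 1) / exp 1 * exp (real (n + 1) / exp 1 - pi / 2)"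
proof -
  define t where "t = n - 4"
  have n: "n = t + 4" using assms by (simp add: t_def)
  define s where "s = (1 / exp 1 :: real)"
  have s: "s > 0.3676"
    using e_less_272 by (simp add: s_def field_simps)
  have es: "exp s \<ge> 1.43"
  proof -
    have "1.43 \<le> 1 + 0.3676 + 0.3676\<^sup>2 / (2::real)" by (simp add: power2_eq_square)
    also have "\<dots> \<le> exp (0.3676::real)" by (rule exp_lower_Taylor_quadratic) simp
    also have "\<dots> \<le> exp s" using s by simp
    finally show ?thesis .
  qed
  \<comment> \<open>\<open>0.763\<close> is an upper bound for \<open>1 - 5 * s + pi / 2\<close>,
    and \<open>0.0476875\<close> is its sixteenth part.\<close>
  have e1: "exp (- 0.763 :: real) \<ge> 5 / 11"
  proof -
    have "5 / 11 \<le> (1 - 0.0476875 :: real) ^ 16" by (simp add: power_numeral_reduce)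
    also have "\<dots> \<le> exp (- 0.0476875) ^ 16"
      using exp_ge_add_one_self[of "- 0.0476875 :: real"] by (intro power_mono) auto
    also have "\<dots> = exp (- 0.763)" by (simp flip: exp_of_nat_mult)
    finally show ?thesis .
  qed
  have "11 / 5 * (real t + 1) < (real t + 5) * (1 + real t * 0.0725)"
  proof -
    have "0 < 0.0725 * (real t - 5.78)\<^sup>2 + (0.37 :: real)" by (simp add: add_nonneg_pos)
    also have "\<dots> = 0.0725 * (real t * real t) - 0.8381 * real t + 2.792109"
      by (simp add: power2_eq_square algebra_simps)
    also have "\<dots> \<le> 0.0725 * (real t * real t) + 1.3625 * real t + 5 - 11 / 5 * (real t + 1)"
      by (simp add: field_simps)
    also have "\<dots> = (real t + 5) * (1 + real t * 0.0725) - 11 / 5 * (real t + 1)"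
      by (simp add: field_simps)
    finally show ?thesis by simp
  qed
  also have "\<dots> \<le> (real t + 5) * (1 + 0.0725) ^ t"
    using Bernoulli_inequality[of "0.0725" t] by (intro mult_left_mono) auto
  finally have main: "real t + 1 < 5 / 11 * (real t + 5) * 1.0725 ^ t"
    by (simp add: field_simps)
  have "(real t + 1) * (4 / 3) ^ t < 5 / 11 * (real t + 5) * 1.0725 ^ t * (4 / 3) ^ t"
    using main by (intro mult_strict_right_mono) auto
  also have "\<dots> = (real t + 5) * (5 / 11) * (1.0725 ^ t * (4 / 3) ^ t)"
    by (simp only: mult_ac)
  also have "1.0725 ^ t * (4 / 3) ^ t = (1.43 :: real) ^ t"
    by (simp flip: power_mult_distrib)
  also have "(real t + 5) * (5 / 11) * 1.43 ^ t \<le> (real t + 5) * exp (- 0.763) * exp s ^ t"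
    using es e1 by (intro mult_mono power_mono mult_nonneg_nonneg) auto
  also have "\<dots> = (real t + 5) * exp (- 0.763 + real t * s)"
    unfolding exp_add exp_of_nat_mult by simp
  also have "\<dots> \<le> (real t + 5) * exp (- 1 + (real (t + 5) * s - pi / 2))"
    using s pi_approx(2) by (intro mult_left_mono) (auto simp: algebra_simps)
  also have "(real t + 5) * exp (- 1 + u) = real (t + 5) * s * exp u" for u
    unfolding exp_add by (simp add: s_def exp_minus divide_inverse)
  finally have "(real t + 1) * (4 / 3) ^ t < real (t + 5) * s * exp (real (t + 5) * s - pi / 2)" .
  moreover have "real (t + 5) * s = real (n + 1) / exp 1" "real t + 1 = real (n - 3)" "t = n - 4"
    by (simp_all add: n s_def)
  ultimately show ?thesis by (simp only:)
qed

text \<open>The exponent \<open>l\<close> depends on \<open>y\<close>: it is real for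
  \<open>y \<le> exp (- 1)\<close>, and otherwise complex with imaginary part \<open>b\<close>,
  where \<open>Re l\<close> changes sign at \<open>b = pi / 2\<close>. The upper bound on
  \<open>y\<close> enters for \<open>b > pi / 2\<close>, where it keeps
  \<open>\<bar>l\<bar> ^ Suc k\<close> below the factorial.\<close>

lemma F_large_at_root:
  assumes y: "y > 0" and root: "F y k 1 = 0" and k: "k \<ge> 4"
    and le: "y \<le> real (k - 2) * (4 / 3) ^ (k - 3)"
  shows "y ^ Suc k / fact (Suc k) < \<bar>F y (Suc k) 1\<bar>"
proof (cases "y \<le> exp (- 1)")
  case True
  \<comment> \<open>A real exponent \<open>l = - w\<close> with
    \<open>w = y * exp w\<close>.\<close>
  have "\<exists>w. 0 \<le> w \<and> w \<le> 1 \<and> w - y * exp w = 0"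
  proof (rule IVT')
    show "0 - y * exp 0 \<le> 0" using y by simp
    have "y * exp 1 \<le> exp (- 1) * exp 1" using True by (intro mult_right_mono) auto
    then show "0 \<le> 1 - y * exp 1" by (simp flip: exp_add)
  qed (auto intro!: continuous_intros)
  then obtain w where w: "0 \<le> w" "w \<le> 1" "w = y * exp w" by auto
  have "complex_of_real (- w) = - of_real y * exp (- of_real (- w))"
    using w(3) by (metis exp_of_real minus_minus mult_minus_left of_real_minus of_real_mult)
  from F_amplitude[OF this y root]
  have "exp (real (Suc k) * - w) \<le> exp w * \<bar>F y (Suc k) 1\<bar>"
    using w by (simp add: max_absorb2)
  then have "exp (- w) * exp (real (Suc k) * - w) \<le> exp (- w) * (exp w * \<bar>F y (Suc k) 1\<bar>)"
    by (intro mult_left_mono) auto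
  also have "\<dots> = (exp (- w) * exp w) * \<bar>F y (Suc k) 1\<bar>" by simp
  also have "exp (- w) * exp w = 1" by (simp flip: exp_add)
  also have "exp (- w) * exp (real (Suc k) * - w) = exp (- w * real (k + 2))"
    by (subst exp_add [symmetric]) (simp add: algebra_simps)
  finally have "exp (- w * real (k + 2)) \<le> \<bar>F y (Suc k) 1\<bar>" by simp
  moreover have "exp (- 1 * real (k + 2)) \<le> exp (- w * real (k + 2))"
    using w by (simp only: exp_le_cancel_iff) (intro mult_right_mono, auto)
  moreover have "y ^ Suc k / fact (Suc k) < exp (- 1 * real (k + 2))"
  proof -
    have "exp 1 < (3::real)" using e_less_272 by simp
    also have "(3::real) \<le> fact (Suc 4)" by (simp add: fact_numeral)
    also have "\<dots> \<le> fact (Suc k)" using k by (intro fact_mono) auto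
    finally have f: "exp 1 < (fact (Suc k) :: real)" .
    have "y ^ Suc k / fact (Suc k) \<le> exp (- 1) ^ Suc k / fact (Suc k)"
      using True y by (intro divide_right_mono power_mono) auto
    also have "\<dots> < exp (- 1) ^ Suc k / exp 1"
      using f by (intro divide_strict_left_mono) auto
    also have "\<dots> = exp (- 1) ^ (k + 2)"
      by (simp add: exp_minus divide_inverse)
    also have "\<dots> = exp (- 1 * real (k + 2))"
      by (metis exp_of_nat_mult mult.commute)
    finally show ?thesis .
  qed
  ultimately show ?thesis by linarith
next
  case False
  then obtain b where b: "0 < b" "b < pi" "y * sin b * exp (b * cos b / sin b) = b"
    using principal_angle[of y] by auto
  have sb: "sin b > 0" using b by (intro sin_gt_zero) auto
  \<comment> \<open>The exponent is \<open>l = a + i * b\<close>, and \<open>r\<close> is its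
    modulus; taking moduli in its equation gives \<open>y = r * exp a\<close>.\<close>
  define a where "a = - (b * cos b / sin b)"
  define r where "r = b / sin b"
  have r: "r > 0" using b sb by (simp add: r_def)
  have yr: "y * exp (- a) = r" using b(3) sb by (simp add: a_def r_def field_simps)
  then have yra: "y = r * exp a" by (auto simp: mult.assoc simp flip: exp_add)
  have "Complex a b = - of_real y * exp (- Complex a b)"
  proof (rule complex_eqI)
    have "Re (- of_real y * exp (- Complex a b)) = - (y * exp (- a)) * cos b"
      by (simp add: Re_exp)
    also have "\<dots> = a" unfolding yr by (simp add: r_def a_def)
    finally show "Re (Complex a b) = Re (- of_real y * exp (- Complex a b))" by simp
    have "Im (- of_real y * exp (- Complex a b)) = y * exp (- a) * sin b"
      by (simp add: Im_exp)
    also have "\<dots> = b" unfolding yr using sb by (simp add: r_def)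
    finally show "Im (Complex a b) = Im (- of_real y * exp (- Complex a b))" by simp
  qed
  from F_amplitude[OF this y root]
  have amp: "exp (real (Suc k) * a) \<le> max 1 (exp (- a)) * \<bar>F y (Suc k) 1\<bar>" by simp
  show ?thesis
  proof (cases "b \<le> pi / 2")
    case True
    then have "cos b \<ge> 0" using b by (intro cos_ge_zero) auto
    then have "a \<le> 0" using b sb by (simp add: a_def)
    then have "exp (real (Suc k) * a) \<le> exp (- a) * \<bar>F y (Suc k) 1\<bar>"
      using amp by (simp add: max_absorb2)
    then have "exp a * exp (real (Suc k) * a) \<le> exp a * (exp (- a) * \<bar>F y (Suc k) 1\<bar>)"
      by (intro mult_left_mono) auto
    also have "\<dots> = (exp a * exp (- a)) * \<bar>F y (Suc k) 1\<bar>" by simp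
    also have "exp a * exp (- a) = 1" by (simp flip: exp_add)
    finally have "exp a * exp (real (Suc k) * a) \<le> \<bar>F y (Suc k) 1\<bar>" by simp
    moreover have "exp a * exp (real (Suc k) * a) = exp a ^ (k + 2)"
      by (simp add: algebra_simps flip: exp_add exp_of_nat_mult power_Suc)
    \<comment> \<open>\<open>0.57\<close> bounds \<open>sin b / b = 1 / r\<close> from below, by the
      cubic estimate with \<open>b \<le> 1.6\<close>.\<close>
    moreover have "0.57 * y \<le> exp a"
    proof -
      have "b\<^sup>2 \<le> 1.6\<^sup>2" using True b pi_approx(2) by (intro power_mono) auto
      then have "0.57 \<le> 1 - b\<^sup>2 / 6" by (simp add: power2_eq_square)
      also have "\<dots> = (b - b ^ 3 / 6) / b" using b by (simp add: field_simps power2_eq_square power3_eq_cube)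
      also have "\<dots> \<le> sin b / b" using b by (intro divide_right_mono sin_ge_cubic) auto
      also have "\<dots> = 1 / r" by (simp add: r_def)
      finally have "0.57 * y \<le> 1 / r * y" using y by (intro mult_right_mono) auto
      also have "\<dots> = exp a" using r by (simp add: yra)
      finally show ?thesis .
    qed
    then have "(0.57 * y) ^ (k + 2) \<le> exp a ^ (k + 2)" using y by (intro power_mono) auto
    moreover have "y ^ Suc k / fact (Suc k) < (0.57 * y) ^ (k + 2)"
    proof -
      \<comment> \<open>The constant 3 is spent against one surplus factor \<open>y > 1 / 3\<close>.
        From \<open>j = 4\<close> on, the growth ratio \<open>0.57 * (j + 2)\<close> exceeds
        1.\<close>
      have "3 < 0.57 ^ (k + 2) * (fact (Suc k) :: real)"
        using k
      proof (induction k rule: dec_induct)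
        case base
        show ?case by (simp add: fact_numeral power_numeral_reduce)
      next
        case (step j)
        have "0.57 ^ (j + 2) * (fact (Suc j) :: real) = 0.57 ^ (j + 2) * fact (Suc j) * 1" by simp
        also have "\<dots> \<le> 0.57 ^ (j + 2) * (fact (Suc j) :: real) * (0.57 * real (j + 2))"
          using step.hyps by (intro mult_left_mono) auto
        also have "\<dots> = 0.57 ^ (Suc j + 2) * fact (Suc (Suc j))" by simp
        finally show ?case using step.IH by linarith
      qed
      moreover have "y > 1 / 3"
      proof -
        have "1 / 3 \<le> exp (- 1 :: real)" using e_less_272 by (simp add: exp_minus field_simps)
        then show ?thesis using False by linarith
      qed
      ultimately have "3 * (1 / 3) < 0.57 ^ (k + 2) * fact (Suc k) * y"
        by (intro mult_strict_mono) auto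
      then have "1 / fact (Suc k) < 0.57 ^ (k + 2) * y"
        by (simp add: field_simps del: fact_Suc power_Suc)
      then have "y ^ Suc k * (1 / fact (Suc k)) < y ^ Suc k * (0.57 ^ (k + 2) * y)"
        using y by (intro mult_strict_left_mono) auto
      also have "y ^ Suc k * (c ^ (k + 2) * y) = (c * y) ^ (k + 2)" for c
        by (simp add: power_mult_distrib)
      finally show ?thesis by simp
    qed
    ultimately show ?thesis by linarith
  next
    case False
    then have "cos b \<le> 0" using b cos_monotone_0_pi_le[of "pi / 2" b] by auto
    then have "a \<ge> 0" using b sb by (simp add: a_def divide_le_0_iff mult_le_0_iff)
    then have amp': "exp (real (Suc k) * a) \<le> \<bar>F y (Suc k) 1\<bar>"
      using amp by (simp add: max_absorb1)
    \<comment> \<open>\<open>r - a = b * (1 + cos b) / sin b\<close>, treated through the half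
      angle.\<close>
    have "r - a \<le> pi / 2"
    proof -
      define x where "x = b / 2"
      have x: "pi / 4 \<le> x" "x \<le> pi / 2" using False b by (auto simp: x_def)
      have bx: "b = 2 * x" by (simp add: x_def)
      have "b * (1 + cos b) = 4 * cos x * (x * cos x)"
        unfolding bx cos_double_cos by (simp add: power2_eq_square)
      also have "\<dots> \<le> 4 * cos x * (pi / 4 * sin x)"
        using x by (intro mult_left_mono mul_cos_le_sin mult_nonneg_nonneg cos_ge_zero) auto
      also have "\<dots> = pi / 2 * sin b" unfolding bx sin_double by simp
      finally show ?thesis using sb by (simp add: r_def a_def field_simps)
    qed
    \<comment> \<open>Otherwise \<open>fact_ge\<close> gives \<open>r \<ge> (k + 2) / exp 1\<close>,
      and with \<open>a \<ge> r - pi / 2\<close> the value \<open>y = r * exp a\<close> would exceed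
      its assumed bound.\<close>
    have "r ^ Suc k < fact (Suc k)"
    proof (rule ccontr)
      assume "\<not> ?thesis"
      then have "(real (Suc k + 1) / exp 1) ^ Suc k \<le> r ^ Suc k"
        using fact_ge[of "Suc k"] by linarith
      then have rge: "real (Suc k + 1) / exp 1 \<le> r"
        using r by (meson less_imp_le power_le_imp_le_base)
      then have "real (Suc k + 1) / exp 1 * exp (real (Suc k + 1) / exp 1 - pi / 2) \<le> r * exp a"
        using \<open>r - a \<le> pi / 2\<close> r by (intro mult_mono) auto
      also have "\<dots> \<le> real (Suc k - 3) * (4 / 3) ^ (Suc k - 4)"
        using le by (simp add: yra)
      finally show False
        using power_4_3_bound[of "Suc k"] k by simp
    qed
    then have "y ^ Suc k / fact (Suc k) < y ^ Suc k / r ^ Suc k"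
      using y r by (intro divide_strict_left_mono) auto
    also have "\<dots> = exp (real (Suc k) * a)"
      unfolding yra exp_of_nat_mult power_mult_distrib using r by simp
    finally show ?thesis using amp' by linarith
  qed
qed

section \<open>Sign changes of the real polynomial\<close>

text \<open>The real polynomial whose complexification is \<open>ptilde_poly 1 n pi\<close> for
  \<open>n \<ge> 1\<close>.\<close>

definition realp :: "nat \<Rightarrow> real poly" where
  "realp n = fpoly n + fpoly (n - 1) - monom ((-1) ^ n / fact n) n"

lemma poly_realp: "poly (realp n) (- y) = F y n 1 + F y (n - 1) 1 - y ^ n / fact n"
proof -
  have "(-1) ^ n * (- y) ^ n = y ^ n" by (simp flip: power_mult_distrib)
  then show ?thesis by (simp add: realp_def poly_fpoly poly_monom)
qed

lemma coeff_realp_less: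
  "i < n \<Longrightarrow> coeff (realp n) i = (real (n - i + 1) ^ i + real (n - i) ^ i) / fact i"
  by (auto simp: realp_def coeff_fpoly add_divide_distrib Suc_diff_Suc)

lemma coeff_realp_self: "n \<ge> 1 \<Longrightarrow> coeff (realp n) n = (1 - (-1) ^ n) / fact n"
  by (simp add: realp_def coeff_fpoly diff_divide_distrib)

lemma coeff_realp_nonneg: "n \<ge> 1 \<Longrightarrow> coeff (realp n) i \<ge> 0"
  by (cases i n rule: linorder_cases)
    (auto simp: coeff_realp_less coeff_realp_self power_minus_even zero_le_divide_iff minus_one_power_iff,
     simp add: realp_def coeff_fpoly)

text \<open>The subtracted monomial doubles the leading term of \<open>fpoly n\<close> for odd
  \<open>n\<close> and cancels it for even \<open>n\<close>.\<close>

lemma degree_realp: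
  assumes "n \<ge> 1"
  shows "degree (realp n) = (if odd n then n else n - 1)"
proof (rule antisym)
  have "coeff (realp n) i = 0" if "i > n" for i
    using that by (simp add: realp_def coeff_fpoly)
  moreover have "coeff (realp n) n = 0" if "even n"
    using assms that by (simp add: coeff_realp_self)
  ultimately have "coeff (realp n) i = 0" if "i > (if odd n then n else n - 1)" for i
    using that by (cases "i = n") (auto split: if_splits)
  then show "degree (realp n) \<le> (if odd n then n else n - 1)"
    by (intro degree_le) auto
  show "(if odd n then n else n - 1) \<le> degree (realp n)"
  proof (cases "odd n")
    case True
    then show ?thesis using assms by (auto intro!: le_degree simp: coeff_realp_self)
  next
    case False
    have "real (n - (n - 1) + 1) ^ (n - 1) + real (n - (n - 1)) ^ (n - 1) > 0"
      using assms by (intro add_pos_pos) auto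
    then show ?thesis using False assms by (auto intro!: le_degree simp: coeff_realp_less)
  qed
qed

lemma lead_coeff_realp:
  assumes "n \<ge> 1"
  shows "lead_coeff (realp n) > 0"
proof -
  have "coeff (realp n) 0 = 2" using assms by (simp add: coeff_realp_less)
  then have "realp n \<noteq> 0" by auto
  then show ?thesis
    using coeff_realp_nonneg[OF assms, of "degree (realp n)"] by (auto simp: less_le)
qed

lemma ptilde_poly_eq:
  assumes "n \<ge> 1"
  shows "ptilde_poly 1 n pi = map_poly of_real (realp n)"
proof (rule poly_eqI)
  fix i
  have *: "coeff (\<Sum>j=0..m. gam_poly (m - j) (of_nat (j + 1))) i = of_real (coeff (fpoly m) i)" for m
  proof -
    \<comment> \<open>Reversing the sum makes the summation index equal to the degree of the
      summand.\<close>
    have "coeff (\<Sum>j=0..m. gam_poly (m - j) (of_nat (j + 1))) i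
        = (\<Sum>j=0..m. coeff (gam_poly (m - (m - j)) (of_nat (m - j + 1))) i)"
      by (subst sum.atLeastAtMost_rev) (simp add: coeff_sum)
    also have "\<dots> = (\<Sum>j=0..m. if j = i then of_nat (m - i + 1) ^ i / fact i else 0)"
      by (intro sum.cong) (auto simp: gam_poly_def)
    also have "\<dots> = of_real (coeff (fpoly m) i)"
      by (simp add: coeff_fpoly)
    finally show ?thesis .
  qed
  obtain m where m: "n = Suc m" using assms by (cases n) auto
  have "exp (- \<i> * complex_of_real pi) = -1" by (simp add: exp_minus)
  then have eq: "ptilde_poly 1 n pi = (\<Sum>j=0..n. gam_poly (n - j) (of_nat (j + 1)))
      + (\<Sum>j=0..m. gam_poly (m - j) (of_nat (j + 1))) - gam_poly n (- 1)"
    by (simp add: ptilde_poly_def m atLeastLessThanSuc_atLeastAtMost)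
  show "coeff (ptilde_poly 1 n pi) i = coeff (map_poly of_real (realp n)) i"
    unfolding eq coeff_add coeff_diff * by (simp add: coeff_map_poly realp_def gam_poly_def m)
qed

lemma roots_of_sign_changes:
  fixes p :: "real poly"
  assumes "\<And>i. i < r \<Longrightarrow> Z i < Z (Suc i)" "\<And>i. i \<le> r \<Longrightarrow> (-1) ^ i * poly p (- Z i) > 0"
  shows "\<exists>A. finite A \<and> card A = r \<and> (\<forall>a\<in>A. poly p a = 0)"
proof -
  have "continuous_on UNIV (\<lambda>x. poly p (- x))" by (intro continuous_intros)
  then obtain R where R: "\<And>i. i < r \<Longrightarrow> Z i < R i" "\<And>i. i < r \<Longrightarrow> R i < Z (Suc i)"
    "\<And>i. i < r \<Longrightarrow> poly p (- R i) = 0"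
    using sign_changes_imp_roots[of "\<lambda>x. poly p (- x)" r Z] assms by metis
  have "R i < R (Suc i)" if "Suc i < r" for i
    using R(2)[of i] R(1)[of "Suc i"] that by auto
  then have "inj_on R {..<r}"
    by (intro strict_mono_on_imp_inj_on strict_mono_on_lessThan)
  then have "inj_on (\<lambda>i. - R i) {..<r}" by (auto simp: inj_on_def)
  then show ?thesis
    using R(3) by (intro exI[of _ "(\<lambda>i. - R i) ` {..<r}"]) (auto simp: card_image)
qed

text \<open>The value at \<open>- Y i\<close> is \<open>F (Y i) n 1 - Y i ^ n / fact n\<close>. For
  even \<open>i\<close> both parts are negative. For odd \<open>i\<close> they compete, and the
  amplitude estimate decides up to index \<open>n - 4\<close>, the third largest root.\<close>

lemma realp_sign_at_root:
  assumes n: "n \<ge> 3" and Y: "\<And>i. i < n - 1 \<Longrightarrow> Y i > 0" "\<And>i. i < n - 1 \<Longrightarrow> F (Y i) (n - 1) 1 = 0"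
    "strict_mono_on {..<n - 1} Y" "\<And>i. i < n - 1 \<Longrightarrow> (-1) ^ i * F (Y i) n 1 < 0"
    and i: "i < n - 1" "odd i \<Longrightarrow> i \<le> n - 4"
  shows "(-1) ^ Suc i * poly (realp n) (- Y i) > 0"
proof (cases "even i")
  case True
  then have "F (Y i) n 1 < 0" using Y(4)[OF i(1)] by simp
  moreover have "Y i ^ n / fact n > 0" using Y(1)[OF i(1)] by simp
  ultimately have "poly (realp n) (- Y i) < 0" unfolding poly_realp using Y(2)[OF i(1)] by linarith
  then show ?thesis using True by simp
next
  case False
  \<comment> \<open>An odd \<open>i\<close> is at least 1, so the subtraction \<open>n - 4\<close>
    is not truncated.\<close>
  then have i': "i \<le> n - 4" "n \<ge> 5" using i(2) by (auto elim: oddE)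
  obtain k where k: "n = Suc k" using n by (cases n) auto
  have eq: "n - 4 + 3 = n - 1" using i' by simp
  have "Y i \<le> Y (n - 4)"
  proof (cases "i = n - 4")
    case False
    moreover have "n - 4 < n - 1" using i' by simp
    ultimately show ?thesis
      using strict_mono_onD[OF Y(3), of i "n - 4"] i(1) i' by simp
  qed simp
  also have "\<dots> \<le> real (n - 4 + 1) * (4 / 3) ^ (n - 4)"
    by (rule F_third_largest_root; unfold eq) (use Y in auto)
  finally have "Y i \<le> real (k - 2) * (4 / 3) ^ (k - 3)"
    using i' by (simp add: k Suc_diff_le numeral_eq_Suc)
  then have "Y i ^ Suc k / fact (Suc k) < \<bar>F (Y i) (Suc k) 1\<bar>"
    using Y(1,2)[OF i(1)] i' by (intro F_large_at_root) (auto simp: k)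
  moreover have "F (Y i) n 1 > 0" using Y(4)[OF i(1)] False by simp
  ultimately have "poly (realp n) (- Y i) > 0"
    unfolding poly_realp using Y(2)[OF i(1)] by (simp add: k)
  then show ?thesis using False by simp
qed

section \<open>Explicit points of positivity near the largest roots\<close>

text \<open>The terms of degrees \<open>2 * i + 1\<close> and \<open>2 * i + 2\<close> together are
  nonnegative.\<close>

lemma alternating_sum_ge:
  fixes c :: "nat \<Rightarrow> real"
  assumes "y \<ge> 0" "\<And>i. i < l \<Longrightarrow> c (2 * i + 1) \<le> y * c (2 * i + 2)"
  shows "(\<Sum>k\<le>2 * l. c k * (- y) ^ k) \<ge> c 0"
  using assms(2)
proof (induction l)
  case (Suc l)
  have "c (2 * l + 1) * y ^ (2 * l + 1) \<le> y * c (2 * l + 2) * y ^ (2 * l + 1)"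
    using Suc.prems[of l] assms(1) by (intro mult_right_mono) auto
  then have "c (2 * l + 1) * (- y) ^ (2 * l + 1) + c (2 * l + 2) * (- y) ^ (2 * l + 2) \<ge> 0"
    by (simp add: algebra_simps)
  with Suc show ?case by simp
qed simp

text \<open>With \<open>m = n - Suc i \<ge> 3\<close>, the bases of the powers grow by the factors
  \<open>(m + 2) / (m + 1)\<close> and \<open>(m + 1) / m\<close>, both at most
  \<open>4 / 3\<close>.\<close>

lemma coeff_realp_ratio:
  assumes "Suc i + 3 \<le> n"
  shows "coeff (realp n) i \<le> real (Suc i) * (4 / 3) ^ i * coeff (realp n) (Suc i)"
proof -
  define m where "m = real (n - Suc i)"
  have m: "m \<ge> 3" "real (n - i) = m + 1" using assms by (auto simp: m_def)
  have "(m + 2) ^ i \<le> (4 / 3) ^ i * (m + 1) ^ i" "(m + 1) ^ i \<le> (4 / 3) ^ i * m ^ i"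
    unfolding power_mult_distrib[symmetric] using m by (auto intro!: power_mono)
  moreover have "(m + 1) ^ i \<le> (m + 1) ^ Suc i" "m ^ i \<le> m ^ Suc i"
    using m by (auto intro!: power_increasing)
  then have "(4 / 3) ^ i * (m + 1) ^ i \<le> (4 / 3) ^ i * (m + 1) ^ Suc i" "(4 / 3) ^ i * m ^ i \<le> (4 / 3) ^ i * m ^ Suc i"
    by (auto intro!: mult_left_mono simp del: power_Suc)
  ultimately have "(m + 2) ^ i + (m + 1) ^ i \<le> (4 / 3) ^ i * ((m + 1) ^ Suc i + m ^ Suc i)"
    unfolding distrib_left by linarith
  then have "((m + 2) ^ i + (m + 1) ^ i) / fact i \<le> (4 / 3) ^ i * ((m + 1) ^ Suc i + m ^ Suc i) / fact i"
    by (rule divide_right_mono) simp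
  also have "\<dots> = real (Suc i) * (4 / 3) ^ i * (((m + 1) ^ Suc i + m ^ Suc i) / fact (Suc i))"
    by (simp del: power_Suc of_nat_Suc add: field_simps)
  finally have *: "((m + 2) ^ i + (m + 1) ^ i) / fact i
      \<le> real (Suc i) * (4 / 3) ^ i * (((m + 1) ^ Suc i + m ^ Suc i) / fact (Suc i))" .
  have e: "real (n - i + 1) = m + 2" "real (n - Suc i + 1) = m + 1" "real (n - Suc i) = m"
    using m by (simp_all add: m_def)
  have "i < n" "Suc i < n" using assms by auto
  with * show ?thesis by (simp only: coeff_realp_less e m(2))
qed

text \<open>\<open>W\<close> dominates the coefficient ratios, so the low-order terms contribute at
  least the constant coefficient 2.\<close>

lemma realp_tail_ge:
  assumes n: "2 * l + 3 \<le> n" and W: "W \<ge> 0"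
    "\<And>k. k < 2 * l \<Longrightarrow> real (Suc k) * (4 / 3) ^ k \<le> W"
  shows "(\<Sum>k\<le>2 * l. coeff (realp n) k * (- W) ^ k) \<ge> 2"
proof -
  have "coeff (realp n) 0 = 2" using n by (simp add: coeff_realp_less)
  moreover have "coeff (realp n) (2 * i + 1) \<le> W * coeff (realp n) (2 * i + 2)" if "i < l" for i
  proof -
    have "coeff (realp n) (2 * i + 1) \<le> real (Suc (2 * i + 1)) * (4 / 3) ^ (2 * i + 1) * coeff (realp n) (Suc (2 * i + 1))"
      using n that by (intro coeff_realp_ratio) auto
    also have "\<dots> \<le> W * coeff (realp n) (Suc (2 * i + 1))"
      using n that by (intro mult_right_mono W coeff_realp_nonneg) auto
    finally show ?thesis by simp
  qed
  ultimately show ?thesis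
    using alternating_sum_ge[OF W(1), of l "coeff (realp n)"] by simp
qed

text \<open>For both parities the degree is \<open>2 * l + 3\<close>. The top three terms form a
  bracket quadratic in \<open>W\<close>, whose sign is what remains to be controlled.\<close>

lemma poly_realp_split:
  assumes "n = 2 * l + 3 \<or> n = 2 * l + 4"
  shows "poly (realp n) (- W) = (\<Sum>k\<le>2 * l. coeff (realp n) k * (- W) ^ k)
    + W ^ (2 * l + 1) * (coeff (realp n) (2 * l + 2) * W - coeff (realp n) (2 * l + 1)
      - coeff (realp n) (2 * l + 3) * W\<^sup>2)"
proof -
  have "degree (realp n) = 2 * l + 3" using assms by (auto simp: degree_realp)
  then have "poly (realp n) (- W) = (\<Sum>k\<le>2 * l + 3. coeff (realp n) k * (- W) ^ k)"
    by (simp add: poly_altdef)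
  also have "\<dots> = (\<Sum>k\<le>2 * l. coeff (realp n) k * (- W) ^ k) + coeff (realp n) (2 * l + 1) * (- W) ^ (2 * l + 1)
      + coeff (realp n) (2 * l + 2) * (- W) ^ (2 * l + 2) + coeff (realp n) (2 * l + 3) * (- W) ^ (2 * l + 3)"
  proof -
    have "2 * l + 3 = Suc (Suc (Suc (2 * l)))" "2 * l + 2 = Suc (Suc (2 * l))" "2 * l + 1 = Suc (2 * l)"
      by simp_all
    then show ?thesis by (simp only: sum.atMost_Suc)
  qed
  also have "(- W) ^ (2 * l + 1) = - (W ^ (2 * l + 1))" by simp
  also have "(- W) ^ (2 * l + 2) = W ^ (2 * l + 1) * W" by simp
  also have "(- W) ^ (2 * l + 3) = - (W ^ (2 * l + 1) * W\<^sup>2)"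
    by (simp add: numeral_3_eq_3 power2_eq_square)
  finally show ?thesis by (simp add: distrib_left right_diff_distrib mult_ac)
qed

text \<open>The point takes the place of the largest root of \<open>F _ (n - 1) 1\<close>, which the
  amplitude estimate does not cover; it lies beyond the second largest root.\<close>

lemma realp_pos_odd:
  assumes n: "n \<ge> 3" "odd n"
  shows "poly (realp n) (- (real n * 2 ^ (n - 3))) > 0"
proof -
  define W where "W = real n * 2 ^ (n - 3)"
  \<comment> \<open>At \<open>W\<close> the term of degree \<open>n - 1\<close> is about twice that of degree \<open>n\<close>.\<close>
  obtain l where l: "n = 2 * l + 3"
  proof
    show "n = 2 * ((n - 3) div 2) + 3" using n by presburger
  qed
  have W: "W \<ge> 0" by (simp add: W_def)
  have tail: "(\<Sum>k\<le>2 * l. coeff (realp n) k * (- W) ^ k) \<ge> 2"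
  proof (rule realp_tail_ge)
    fix k assume k: "k < 2 * l"
    have "(4 / 3 :: real) ^ k \<le> 2 ^ k" by (intro power_mono) auto
    also have "\<dots> \<le> 2 ^ (n - 3)" using k l by (intro power_increasing) auto
    finally show "real (Suc k) * (4 / 3) ^ k \<le> W"
      unfolding W_def using k l by (intro mult_mono) auto
  qed (use l W in auto)
  have c: "coeff (realp n) (2 * l + 1) = (3 ^ (2 * l + 1) + 2 ^ (2 * l + 1)) / fact (2 * l + 1)"
    "coeff (realp n) (2 * l + 2) = (2 * 2 ^ (2 * l + 1) + 1) / fact (2 * l + 2)"
    "coeff (realp n) (2 * l + 3) = 2 / fact (2 * l + 3)"
    using l coeff_realp_self[of n] by (auto simp: coeff_realp_less)
  show ?thesis
  proof (cases "l = 0")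
    \<comment> \<open>For \<open>n = 3\<close> the bracket is \<open>- 1 / 2\<close>, but the
      constant term wins: \<open>2 - 3 / 2 > 0\<close>.\<close>
    case True
    then show ?thesis
      using poly_realp_split[of n l W] tail c l by (simp add: W_def power2_eq_square fact_numeral)
  next
    case False
    define u where "u = 2 * l + 1"
    have u: "u \<ge> 3" using False by (simp add: u_def)
    have idx: "2 * l + 1 = u" "2 * l + 2 = u + 1" "2 * l + 3 = u + 2" by (simp_all add: u_def)
    have "real (u + 1) * (3 ^ u + 2 ^ u) \<le> W * (2 ^ u + 1)"
    proof (cases "u = 3")
      case True
      then show ?thesis using l by (simp add: W_def u_def)
    next
      case F: False
      then have "u \<ge> 4" using u by simp
      \<comment> \<open>This fails at \<open>u = 3\<close>, where \<open>35 > 32\<close>; hence the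
        separate case.\<close>
      then have "(3 :: real) ^ u + 2 ^ u \<le> 2 ^ u * 2 ^ u / 2"
      proof (induction u rule: dec_induct)
        case (step j)
        have "(3 :: real) ^ Suc j + 2 ^ Suc j \<le> 4 * (3 ^ j + 2 ^ j)" by simp
        also have "\<dots> \<le> 4 * (2 ^ j * 2 ^ j / 2)" using step.IH by (intro mult_left_mono) auto
        finally show ?case by simp
      qed simp
      then have "real (u + 1) * (3 ^ u + 2 ^ u) \<le> real (u + 2) * (2 ^ u * 2 ^ u / 2)"
        by (intro mult_mono) auto
      also have "\<dots> = W * 2 ^ u" using l False by (simp add: W_def u_def power_add algebra_simps)
      also have "\<dots> \<le> W * (2 ^ u + 1)" using W by (simp add: algebra_simps)
      finally show ?thesis .
    qed
    \<comment> \<open>By the choice of \<open>W\<close> the top term takes \<open>W * 2 ^ u\<close>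
      and leaves \<open>W * (2 ^ u + 1)\<close> of the middle one.\<close>
    moreover have "2 * W\<^sup>2 / real (u + 2) = W * 2 ^ u"
      using l False by (simp add: W_def u_def power2_eq_square field_simps)
    ultimately have "0 \<le> (2 * 2 ^ u + 1) * W - real (u + 1) * (3 ^ u + 2 ^ u) - 2 * W\<^sup>2 / real (u + 2)"
      by (simp add: algebra_simps)
    then have "0 \<le> ((2 * 2 ^ u + 1) * W - real (u + 1) * (3 ^ u + 2 ^ u) - 2 * W\<^sup>2 / real (u + 2)) / fact (u + 1)"
      by (intro divide_nonneg_pos) auto
    also have "\<dots> = (2 * 2 ^ u + 1) / fact (u + 1) * W - (3 ^ u + 2 ^ u) / fact u - 2 / fact (u + 2) * W\<^sup>2"
    proof -
      have "real (u + 1) * x / fact (u + 1) = x / fact u" for x :: real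
        by (simp del: of_nat_add of_nat_Suc)
      moreover have "x / real (u + 2) / fact (u + 1) = x / fact (u + 2)" for x :: real
        by (simp del: of_nat_add of_nat_Suc)
      ultimately show ?thesis unfolding diff_divide_distrib by simp
    qed
    finally have "0 \<le> coeff (realp n) (2 * l + 2) * W - coeff (realp n) (2 * l + 1) - coeff (realp n) (2 * l + 3) * W\<^sup>2"
      unfolding c unfolding idx .
    then have "0 \<le> W ^ (2 * l + 1) * (coeff (realp n) (2 * l + 2) * W - coeff (realp n) (2 * l + 1) - coeff (realp n) (2 * l + 3) * W\<^sup>2)"
      using W by (intro mult_nonneg_nonneg) auto
    with tail poly_realp_split[of n l W] l show ?thesis by (simp add: W_def)
  qed
qed

text \<open>The point takes the place of the second largest root of \<open>F _ (n - 1) 1\<close> and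
  lies beyond the bound for the third largest. As the degree is \<open>n - 1\<close>, the largest
  root can be left out of the chain.\<close>

lemma realp_pos_even:
  assumes n: "n \<ge> 4" "even n"
  obtains W where "W > real (n - 3) * (4 / 3) ^ (n - 4)" "poly (realp n) (- W) > 0"
proof -
  obtain l where l: "n = 2 * l + 4"
  proof
    show "n = 2 * ((n - 4) div 2) + 4" using n by presburger
  qed
  have c: "coeff (realp n) (2 * l + 1) = (4 ^ (2 * l + 1) + 3 ^ (2 * l + 1)) / fact (2 * l + 1)"
    "coeff (realp n) (2 * l + 2) = (3 ^ (2 * l + 2) + 2 ^ (2 * l + 2)) / fact (2 * l + 2)"
    "coeff (realp n) (2 * l + 3) = (2 ^ (2 * l + 3) + 1) / fact (2 * l + 3)"
    using l by (auto simp: coeff_realp_less)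
  \<comment> \<open>Explicit integers serve for \<open>n = 4, 6, 8\<close>; the general estimate
    starts at \<open>t = n - 2 = 8\<close>.\<close>
  consider "l = 0" | "l = 1" | "l = 2" | "l \<ge> 3" by linarith
  then show thesis
  proof cases
    case 1
    have "poly (realp n) (- 2) > 0"
      using poly_realp_split[of n l 2] c l 1 by (simp add: coeff_realp_less fact_numeral)
    then show thesis using l 1 by (intro that[of 2]) auto
  next
    case 2
    have "poly (realp n) (- 7) > 0"
    proof -
      have "(\<Sum>k\<le>2 * l. g k) = g 0 + g 1 + g 2" for g :: "nat \<Rightarrow> real"
        using 2 by (simp add: numeral_2_eq_2)
      then show ?thesis
        using poly_realp_split[of n l 7] c l 2 by (simp add: coeff_realp_less fact_numeral)
    qed
    then show thesis using l 2 by (intro that[of 7]) (auto simp: power2_eq_square)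
  next
    case 3
    have "poly (realp n) (- 21) > 0"
    proof -
      have "(\<Sum>k\<le>2 * l. coeff (realp n) k * (- 21) ^ k) \<ge> 2"
      proof (rule realp_tail_ge)
        fix k assume "k < 2 * l"
        then have "real (Suc k) * (4 / 3) ^ k \<le> 4 * (4 / 3) ^ 3"
          using 3 by (intro mult_mono power_increasing) auto
        also have "\<dots> \<le> 21" by (simp add: power3_eq_cube)
        finally show "real (Suc k) * (4 / 3) ^ k \<le> 21" .
      qed (use l in auto)
      then show ?thesis
        using poly_realp_split[of n l 21] c l 3 by (simp add: fact_numeral)
    qed
    then show thesis using l 3 by (intro that[of 21]) (auto simp: power_numeral_reduce)
  next
    case 4
    define t where "t = 2 * l + 2"
    \<comment> \<open>\<open>W\<close> is the vertex of the bracket once \<open>2 ^ t\<close> is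
      dropped from its middle and 1 from its top coefficient.\<close>
    define w where "w = (3 / 2 :: real) ^ t / 4"
    define W where "W = real (t + 1) * w"
    have t: "t \<ge> 8" using 4 by (simp add: t_def)
    have A: "(9 / 8 :: real) ^ t \<ge> 5 / 2"
    proof -
      have "5 / 2 \<le> (9 / 8 :: real) ^ 8" by (simp add: power_numeral_reduce)
      also have "\<dots> \<le> (9 / 8) ^ t" using t by (intro power_increasing) auto
      finally show ?thesis .
    qed
    have B: "(3 / 4 :: real) ^ t \<le> 11 / 100"
    proof -
      have "(3 / 4 :: real) ^ t \<le> (3 / 4) ^ 8" using t by (intro power_decreasing) auto
      also have "\<dots> \<le> 11 / 100" by (simp add: power_numeral_reduce)
      finally show ?thesis .
    qed
    have big: "real (t - 1) * (4 / 3) ^ (t - 2) < W"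
    proof -
      have "real (t - 1) * (4 / 3) ^ (t - 2) = real (t - 1) * (9 / 16 * (4 / 3) ^ t)"
        using t power_diff[of "4 / 3 :: real" 2 t] by (simp add: field_simps)
      also have "\<dots> < real (t + 1) * (1 / 4 * (9 / 8) ^ t * (4 / 3) ^ t)"
      proof (rule mult_strict_mono)
        have "9 / 16 * (4 / 3 :: real) ^ t < (1 / 4 * (5 / 2)) * (4 / 3) ^ t" by simp
        also have "\<dots> \<le> 1 / 4 * (9 / 8) ^ t * (4 / 3) ^ t"
          using A by (intro mult_right_mono) auto
        finally show "9 / 16 * (4 / 3 :: real) ^ t < 1 / 4 * (9 / 8) ^ t * (4 / 3) ^ t" .
      qed auto
      also have "(9 / 8 :: real) ^ t * (4 / 3) ^ t = (3 / 2) ^ t"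
        by (simp flip: power_mult_distrib)
      then have "real (t + 1) * (1 / 4 * (9 / 8) ^ t * (4 / 3) ^ t) = W"
        by (simp add: W_def w_def)
      finally show ?thesis .
    qed
    have W: "W > 0" by (simp add: W_def w_def)
    have tail: "(\<Sum>k\<le>2 * l. coeff (realp n) k * (- W) ^ k) \<ge> 2"
    proof (rule realp_tail_ge)
      fix k assume k: "k < 2 * l"
      have "real (Suc k) * (4 / 3) ^ k \<le> real (t - 1) * (4 / 3) ^ (t - 2)"
        using k by (intro mult_mono power_increasing) (auto simp: t_def)
      with big show "real (Suc k) * (4 / 3) ^ k \<le> W" by linarith
    qed (use l W in auto)
    \<comment> \<open>After division by \<open>4 ^ t\<close> the terms are multiples of powers of
      \<open>9 / 8\<close>, \<open>3 / 4\<close>, \<open>9 / 16\<close> and of 1. The net gain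
      \<open>(9 / 8) ^ t / 8\<close> is at least \<open>5 / 16\<close> by \<open>A\<close>, against
      a loss of \<open>1 / 4\<close> and small terms bounded by \<open>B\<close>.\<close>
    have main: "0 \<le> (3 ^ t + 2 ^ t) * w - (2 * 2 ^ t + 1) * w\<^sup>2 - (4 ^ t / 4 + 3 ^ t / 3)"
    proof -
      define x where "x = (4 :: real) ^ t"
      have x: "x > 0" by (simp add: x_def)
      have e: "3 ^ t * w = (9 / 8) ^ t * x / 4" "2 ^ t * w = (3 / 4) ^ t * x / 4"
        "2 * 2 ^ t * w\<^sup>2 = (9 / 8) ^ t * x / 8" "w\<^sup>2 = (9 / 16) ^ t * x / 16" "3 ^ t = (3 / 4) ^ t * x"
        unfolding w_def x_def power2_eq_square
        by (simp_all flip: power_mult_distrib)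
      have "(9 / 16 :: real) ^ t \<le> (3 / 4) ^ t" by (intro power_mono) auto
      then have "(9 / 16) ^ t * x \<le> 11 / 100 * x" using B x by (intro mult_right_mono) auto
      moreover have "(3 / 4) ^ t * x \<le> 11 / 100 * x" using B x by (intro mult_right_mono) auto
      moreover have "5 / 2 * x \<le> (9 / 8) ^ t * x" using A x by (intro mult_right_mono) auto
      ultimately have "0 \<le> ((9 / 8) ^ t * x / 4 + (3 / 4) ^ t * x / 4) - ((9 / 8) ^ t * x / 8 + (9 / 16) ^ t * x / 16)
          - (x / 4 + (3 / 4) ^ t * x / 3)"
        using x by linarith
      moreover have "(3 ^ t + 2 ^ t) * w = (9 / 8) ^ t * x / 4 + (3 / 4) ^ t * x / 4"
        by (simp only: distrib_right e(1,2))
      moreover have "(2 * 2 ^ t + 1) * w\<^sup>2 = 2 * 2 ^ t * w\<^sup>2 + w\<^sup>2"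
        by (simp only: distrib_right mult_1)
      moreover have "2 * 2 ^ t * w\<^sup>2 + w\<^sup>2 = (9 / 8) ^ t * x / 8 + (9 / 16) ^ t * x / 16"
        by (rule arg_cong2[of _ _ _ _ "(+)", OF e(3,4)])
      moreover have "4 ^ t / 4 + 3 ^ t / 3 = x / 4 + (3 / 4) ^ t * x / 3"
        by (simp only: e(5) x_def[symmetric])
      ultimately show ?thesis by simp
    qed
    have "real t * (4 ^ t / 4 + 3 ^ t / 3) \<le> real (t + 1) * (4 ^ t / 4 + 3 ^ t / 3 :: real)"
      by (intro mult_right_mono) auto
    moreover have "0 \<le> real (t + 1) * ((3 ^ t + 2 ^ t) * w - (2 * 2 ^ t + 1) * w\<^sup>2 - (4 ^ t / 4 + 3 ^ t / 3))"
      using main by (intro mult_nonneg_nonneg) auto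
    moreover have "(2 * 2 ^ t + 1) * W\<^sup>2 / real (t + 1) = real (t + 1) * ((2 * 2 ^ t + 1) * w\<^sup>2)"
      by (simp add: W_def power2_eq_square field_simps)
    ultimately have "0 \<le> (3 ^ t + 2 ^ t) * W - (2 * 2 ^ t + 1) * W\<^sup>2 / real (t + 1) - real t * (4 ^ t / 4 + 3 ^ t / 3)"
      by (simp add: W_def algebra_simps)
    then have "0 \<le> ((3 ^ t + 2 ^ t) * W - (2 * 2 ^ t + 1) * W\<^sup>2 / real (t + 1) - real t * (4 ^ t / 4 + 3 ^ t / 3)) / fact t"
      by (intro divide_nonneg_pos) auto
    also have "\<dots> = (3 ^ t + 2 ^ t) / fact t * W - real t * (4 ^ t / 4 + 3 ^ t / 3) / fact t - (2 * 2 ^ t + 1) / fact (Suc t) * W\<^sup>2"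
    proof -
      have "x / real (t + 1) / fact t = x / fact (Suc t)" for x :: real
        by (simp add: mult.commute)
      then show ?thesis unfolding diff_divide_distrib by simp
    qed
    also have "real t * (4 ^ t / 4 + 3 ^ t / 3) / fact t = (4 ^ (2 * l + 1) + 3 ^ (2 * l + 1)) / fact (2 * l + 1)"
    proof -
      have "t = Suc (2 * l + 1)" by (simp add: t_def)
      moreover have "real (Suc u) * x / fact (Suc u) = x / fact u" for u and x :: real
        by (simp del: of_nat_Suc)
      moreover have "4 ^ Suc u / 4 + 3 ^ Suc u / 3 = (4 ^ u + 3 ^ u :: real)" for u :: nat
        by simp
      ultimately show ?thesis by (simp only:)
    qed
    finally have "0 \<le> coeff (realp n) (2 * l + 2) * W - coeff (realp n) (2 * l + 1) - coeff (realp n) (2 * l + 3) * W\<^sup>2"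
      unfolding c by (simp add: t_def numeral_3_eq_3 del: fact_Suc)
    then have "0 \<le> W ^ (2 * l + 1) * (coeff (realp n) (2 * l + 2) * W - coeff (realp n) (2 * l + 1) - coeff (realp n) (2 * l + 3) * W\<^sup>2)"
      using W by (intro mult_nonneg_nonneg) auto
    with tail poly_realp_split[of n l W] l have "poly (realp n) (- W) > 0" by simp
    then show thesis using big by (intro that[of W]) (auto simp: t_def l)
  qed
qed

section \<open>Counting sign changes against the degree\<close>

lemma poly_realp_0: "n \<ge> 1 \<Longrightarrow> poly (realp n) 0 = 2"
  by (simp add: poly_0_coeff_0 coeff_realp_less)

lemma realp_roots:
  assumes n: "n \<ge> 1"
  shows "\<exists>A. finite A \<and> card A = degree (realp n) \<and> (\<forall>a\<in>A. poly (realp n) a = 0)"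
proof (cases "n \<ge> 3")
  case False
  then have deg: "degree (realp n) = 1" using n by (auto simp: degree_realp elim: oddE)
  obtain B where B: "B > 0" "(-1) ^ degree (realp n) * poly (realp n) (- B) > 0"
    using poly_sign_at_minus_infinity[OF lead_coeff_realp[OF n]] by metis
  have "poly (realp n) 0 > 0" using poly_realp_0[OF n] by simp
  then show ?thesis unfolding deg using B
    by (intro roots_of_sign_changes[where Z = "\<lambda>i. real i * B"]) (auto simp: deg le_Suc_eq)
next
  case True
  obtain Y where Y: "\<And>i. i < n - 1 \<Longrightarrow> Y i > 0" "\<And>i. i < n - 1 \<Longrightarrow> F (Y i) (n - 1) 1 = 0"
    "strict_mono_on {..<n - 1} Y" "\<And>i. i < n - 1 \<Longrightarrow> (-1) ^ i * F (Y i) n 1 < 0"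
    using F_roots[of "n - 1"] n by auto
  \<comment> \<open>The number of roots \<open>Y i\<close> that are kept: all but the largest for
    odd \<open>n\<close>, all but the two largest for even \<open>n\<close>. As \<open>D\<close> is
    odd, the last kept value is negative, and positivity at \<open>W\<close> continues the
    alternation.\<close>
  define D where "D = (if odd n then n - 2 else n - 3)"
  have D: "odd D" "D < n - 1" "degree (realp n) = D + 2"
    using True by (auto simp: D_def degree_realp)
  obtain W where W: "W > Y (D - 1)" "poly (realp n) (- W) > 0"
  proof (cases "odd n")
    case odd: True
    have eq: "n - 3 + 2 = n - 1" "n - 3 = D - 1" using odd True by (auto simp: D_def)
    have "Y (n - 3) \<le> real (n - 3 + 1) * (3 / 2) ^ (n - 3)"
      by (rule F_second_largest_root; unfold eq(1)) (use Y in auto)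
    also have "\<dots> < real n * 2 ^ (n - 3)"
    proof -
      have "(3 / 2 :: real) ^ (n - 3) \<le> 2 ^ (n - 3)" by (intro power_mono) auto
      then have "real (n - 3 + 1) * (3 / 2) ^ (n - 3) \<le> real (n - 3 + 1) * 2 ^ (n - 3)"
        by (intro mult_left_mono) auto
      also have "\<dots> < real n * 2 ^ (n - 3)" using True by (intro mult_strict_right_mono) auto
      finally show ?thesis .
    qed
    finally show thesis
      using realp_pos_odd[OF True odd] eq(2) that by simp
  next
    case even: False
    have "n \<ge> 4" using even True by presburger
    then have eq: "n - 4 + 3 = n - 1" "n - 4 = D - 1" "n - 4 + 1 = n - 3"
      using even by (auto simp: D_def)
    have "Y (n - 4) \<le> real (n - 4 + 1) * (4 / 3) ^ (n - 4)"
      by (rule F_third_largest_root; unfold eq(1)) (use Y in auto)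
    then have le: "Y (n - 4) \<le> real (n - 3) * (4 / 3) ^ (n - 4)" by (simp only: eq(3))
    obtain W where W: "W > real (n - 3) * (4 / 3) ^ (n - 4)" "poly (realp n) (- W) > 0"
      using realp_pos_even[OF \<open>n \<ge> 4\<close>] even by auto
    have "Y (D - 1) < W" using le W(1) unfolding eq(2) by (rule le_less_trans)
    then show thesis using W(2) that by blast
  qed
  obtain B where B: "B > W" "(-1) ^ degree (realp n) * poly (realp n) (- B) > 0"
    using poly_sign_at_minus_infinity[OF lead_coeff_realp[OF n]] by metis
  \<comment> \<open>The chain \<open>0, Y 0, ..., Y (D - 1), W, B\<close> has \<open>D + 3\<close>
    points, hence \<open>D + 2\<close> sign changes, which is the degree.\<close>
  define Z where "Z i = (if i = 0 then 0 else if i \<le> D then Y (i - 1) else if i = Suc D then W else B)" for i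
  show ?thesis unfolding D(3)
  proof (rule roots_of_sign_changes)
    fix i assume i: "i < D + 2"
    consider "i = 0" | "0 < i" "i < D" | "i = D" | "i = Suc D" using i by linarith
    then show "Z i < Z (Suc i)"
    proof cases
      case 1
      then show ?thesis using Y(1)[of 0] D by (auto simp: Z_def elim: oddE)
    next
      case 2
      then show ?thesis using strict_mono_onD[OF Y(3), of "i - 1" i] D by (auto simp: Z_def)
    next
      case 3
      then show ?thesis using W D by (auto simp: Z_def elim: oddE)
    next
      case 4
      then show ?thesis using B by (auto simp: Z_def)
    qed
  next
    fix i assume i: "i \<le> D + 2"
    consider "i = 0" | j where "i = Suc j" "j < D" | "i = Suc D" | "i = D + 2"
    proof -
      have "i = 0 \<or> (\<exists>j. i = Suc j \<and> j < D) \<or> i = Suc D \<or> i = D + 2"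
        using i by (cases i) auto
      then show ?thesis using that by blast
    qed
    then show "(-1) ^ i * poly (realp n) (- Z i) > 0"
    proof cases
      case 1
      then show ?thesis using poly_realp_0[OF n] by (simp add: Z_def)
    next
      case 2
      have "j \<le> n - 4" if "odd j"
      proof -
        have "j + 2 \<le> D" using that 2(2) D(1) by presburger
        moreover have "D + 2 \<le> n" using True D(1) by (auto simp: D_def split: if_splits)
        ultimately show ?thesis by linarith
      qed
      then have "(-1) ^ Suc j * poly (realp n) (- Y j) > 0"
        using 2 D(2) by (intro realp_sign_at_root True Y) auto
      then show ?thesis using 2 by (simp add: Z_def)
    next
      case 3
      then show ?thesis using W D(1) by (simp add: Z_def)
    next
      case 4
      then show ?thesis using B D(3) by (simp add: Z_def)
    qed
  qed
qed

section \<open>Transfer to the complex polynomial\<close>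

lemma order_prod_linear:
  fixes c :: "'a :: field"
  assumes "c \<noteq> 0" "finite A" "a \<in> A"
  shows "order a (smult c (\<Prod>b\<in>A. [:- b, 1:])) = 1"
proof -
  define q where "q = smult c (\<Prod>b\<in>A - {a}. [:- b, 1:])"
  have "poly q a \<noteq> 0" using assms by (auto simp: q_def poly_prod)
  moreover have "smult c (\<Prod>b\<in>A. [:- b, 1:]) = [:- a, 1:] * q"
    unfolding q_def mult_smult_right prod.remove[OF assms(2,3)] ..
  moreover have "order a [:- a, 1:] = 1" using order_power_n_n[of a 1] by simp
  ultimately show ?thesis
    by (metis add.right_neutral mult_eq_0_iff order_mult order_root pCons_eq_0_iff poly_0 zero_neq_one)
qed

text \<open>The distinct real roots already match the degree, so they exhaust the complex zeros and
  each is simple.\<close>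

lemma ptilde_zeros:
  assumes n: "n \<ge> 1" and zero: "ptilde 1 n pi \<zeta> = 0"
  shows "\<zeta> \<in> \<real>" "order \<zeta> (ptilde_poly 1 n pi) = 1"
proof -
  let ?P = "ptilde_poly 1 n pi"
  obtain A where A: "finite A" "card A = degree (realp n)" "\<And>a. a \<in> A \<Longrightarrow> poly (realp n) a = 0"
    using realp_roots[OF n] by auto
  have deg: "degree ?P = degree (realp n)"
    unfolding ptilde_poly_eq[OF n] by (rule degree_map_poly) auto
  have root: "poly ?P (of_real a) = of_real (poly (realp n) a)" for a
    unfolding poly_altdef deg by (simp add: ptilde_poly_eq[OF n] coeff_map_poly)
  have inj: "inj_on complex_of_real A" by (auto simp: inj_on_def)
  have P: "?P = smult (lead_coeff ?P) (\<Prod>a\<in>of_real ` A. [:- a, 1:])"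
    by (rule poly_eq_prod_roots) (use A root in \<open>auto simp: deg card_image[OF inj]\<close>)
  have lead: "lead_coeff ?P \<noteq> 0"
    using lead_coeff_realp[OF n] unfolding deg by (auto simp: ptilde_poly_eq[OF n] coeff_map_poly)
  have "poly (smult (lead_coeff ?P) (\<Prod>a\<in>of_real ` A. [:- a, 1:])) \<zeta> = 0"
    using zero P by (metis poly_ptilde_poly)
  then have mem: "\<zeta> \<in> of_real ` A"
    using lead A(1) by (auto simp: poly_prod)
  then show "\<zeta> \<in> \<real>" by auto
  show "order \<zeta> ?P = 1"
    by (subst P, rule order_prod_linear) (use lead A(1) mem in auto)
qed

text \<open>The constant coefficient is 2, so continuity at 0 suffices.\<close>

lemma ptilde_no_zero_near_0:
  assumes "n \<ge> 1"
  shows "\<exists>e>0. \<forall>x\<in>{- e<..0}. ptilde 1 n pi (complex_of_real x) \<noteq> 0"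
proof -
  have "continuous (at 0) (\<lambda>x. ptilde 1 n pi (complex_of_real x))"
    unfolding poly_ptilde_poly[symmetric] by (intro continuous_intros)
  moreover have "ptilde 1 n pi (complex_of_real 0) \<noteq> 0"
  proof -
    have "ptilde 1 n pi (complex_of_real 0) = coeff (ptilde_poly 1 n pi) 0"
      by (simp add: poly_0_coeff_0 flip: poly_ptilde_poly)
    also have "\<dots> = 2"
      using assms by (simp add: ptilde_poly_eq coeff_map_poly coeff_realp_less)
    finally show ?thesis by simp
  qed
  ultimately obtain e where e: "e > 0" "\<And>x. dist 0 x < e \<Longrightarrow> ptilde 1 n pi (complex_of_real x) \<noteq> 0"
    using continuous_at_avoid[of "0::real"] by blast
  have "ptilde 1 n pi (complex_of_real x) \<noteq> 0" if "x \<in> {- e<..0}" for x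
    using that by (intro e(2)) (auto simp: dist_real_def)
  then show ?thesis using e(1) by blast
qed

theorem theorem1:
  shows "(\<forall>n\<ge>1. \<forall>\<zeta>::complex. ptilde 1 n pi \<zeta> = 0 \<longrightarrow>
            \<zeta> \<in> \<real> \<and> order \<zeta> (ptilde_poly 1 n pi) = 1)
       \<and> (\<exists>r :: nat \<Rightarrow> real.
            (\<forall>N. r N \<ge> 0)
          \<and> (\<forall>N n. 1 \<le> n \<and> n < N \<longrightarrow>
               (\<forall>x \<in> {- r N <.. 0}. ptilde 1 n pi (complex_of_real x) \<noteq> 0))
          \<and> (\<forall>M N. M < N \<longrightarrow> r N < r M))"
proof (intro conjI)
  show "\<forall>n\<ge>1. \<forall>\<zeta>::complex. ptilde 1 n pi \<zeta> = 0 \<longrightarrow>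
            \<zeta> \<in> \<real> \<and> order \<zeta> (ptilde_poly 1 n pi) = 1"
    using ptilde_zeros by blast
next
  obtain e where e: "\<And>n. n \<ge> 1 \<Longrightarrow> e n > 0"
    "\<And>n x. n \<ge> 1 \<Longrightarrow> x \<in> {- e n<..0} \<Longrightarrow> ptilde 1 n pi (complex_of_real x) \<noteq> 0"
    using ptilde_no_zero_near_0 by metis
  \<comment> \<open>\<open>insert 1\<close> keeps the set nonempty for \<open>N \<le> 1\<close>,
    where \<open>Min\<close> would otherwise be unspecified.\<close>
  define m where "m N = Min (insert 1 (e ` {1..<N}))" for N
  \<comment> \<open>\<open>m\<close> decreases only weakly; the divisor makes \<open>r\<close>
    strictly decreasing and keeps \<open>r N \<le> m N\<close>.\<close>
  define r where "r N = m N / real (N + 1)" for N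
  have m: "m N > 0" for N using e(1) by (auto simp: m_def)
  have me: "m N \<le> e n" if "1 \<le> n" "n < N" for n N
    unfolding m_def by (rule Min_le) (use that in auto)
  have mono: "m N \<le> m M" if "M \<le> N" for M N
    unfolding m_def using that by (intro Min_antimono) auto
  show "\<exists>r :: nat \<Rightarrow> real.
            (\<forall>N. r N \<ge> 0)
          \<and> (\<forall>N n. 1 \<le> n \<and> n < N \<longrightarrow>
               (\<forall>x \<in> {- r N <.. 0}. ptilde 1 n pi (complex_of_real x) \<noteq> 0))
          \<and> (\<forall>M N. M < N \<longrightarrow> r N < r M)"
  proof (intro exI[of _ r] conjI allI impI ballI)
    fix N show "r N \<ge> 0" using m[of N] by (simp add: r_def)
  next
    fix N n x assume n: "1 \<le> n \<and> n < N" and x: "x \<in> {- r N<..0}"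
    have "r N \<le> m N" using m[of N] by (simp add: r_def field_simps)
    then have "x \<in> {- e n<..0}" using x me[of n N] n by auto
    then show "ptilde 1 n pi (complex_of_real x) \<noteq> 0" using e(2) n by blast
  next
    fix M N :: nat assume "M < N"
    have "r N = m N / real (N + 1)" by (simp add: r_def)
    also have "\<dots> < m N / real (M + 1)" using \<open>M < N\<close> m[of N] by (intro divide_strict_left_mono) auto
    also have "\<dots> \<le> r M" unfolding r_def using mono[of M N] \<open>M < N\<close> by (intro divide_right_mono) auto
    finally show "r N < r M" .
  qed
qed

end
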